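(* Let $\mathcal H$ be a finite-dimensional Hilbert space, $\mathbb P:=B(\mathcal H)^{++}$, $n\ge2$, and let $M:\mathbb P^n\to\mathbb P$ satisfy (A) joint monotonicity, (B) homogeneity, (C) monotone continuity, (D) normalization, and (G) with a weight vector $\mathbf w$, i.e. $\mathcal H_{\mathbf w}(A_1,\dots,A_n)\le M(A_1,\dots,A_n)\le\mathcal A_{\mathbf w}(A_1,\dots,A_n)$ for all $A_j\in\mathbb P$. Define, for $s\in[0,1]$ and $r\in[-1,1]$, $$M_{s,r}:=\begin{cases} M_{\mathfrak p_{s,r}} & s\in(0,1],\ r\in[-1,1], \\ {P}_{\mathbf w,r} & s=0,\ r\in[-1,1]\setminus\{0\}, \\ {G}_{\mathbf w} & s=0,\ r=0. \end{cases}$$ Then the family $M_{s,r}$ is continuous in $(s,r)\in[0,1]\times[-1,1]$ in the sense of pointwise operator norm convergence; that is, for every $A_1,\dots,A_n\in\mathbb P$ the map $(s,r)\mapsto M_{s,r}(A_1,\dots,A_n)$ is continuous from $[0,1]\times[-1,1]$ to $\mathbb P$ in the operator norm.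
   Context: $B(\mathcal H)^{++}=\mathbb P$ is the set of positive invertible operators on $\mathcal H$. A weight vector is $\mathbf w=(w_1,\dots,w_n)$ with $w_j\ge0$, $\sum_jw_j=1$. $\mathcal A_{\mathbf w}(A_1,\dots,A_n)=\sum_jw_jA_j$ and $\mathcal H_{\mathbf w}(A_1,\dots,A_n)=\bigl(\sum_jw_jA_j^{-1}\bigr)^{-1}$. $G_{\mathbf w}(A_1,\dots,A_n)$ (Karcher mean) is the unique solution $X\in\mathbb P$ of $\sum_jw_j\log(X^{-1/2}A_jX^{-1/2})=0$. The multivariate weighted power mean $P_{\mathbf w,r}(A_1,\dots,A_n)$ is the unique solution $X\in\mathbb P$ of $X=\mathcal A_{\mathbf w}(X\#_rA_1,\dots,X\#_rA_n)$ if $0<r\le1$, and of $X=\mathcal H_{\mathbf w}(X\#_{-r}A_1,\dots,X\#_{-r}A_n)$ if $-1\le r<0$. Properties of $M$: (A) if $A_j\le B_j$ for all $j$, then $M(A_1,\dots,A_n)\le M(B_1,\dots,B_n)$; (B) $M(\alpha A_1,\dots,\alpha A_n)=\alpha M(A_1,\dots,A_n)$ for $\alpha>0$; (C) if $A_{j,k}\searrow A_j\in\mathbb P$ as $k\to\infty$ for all $j$ (decreasing, strong convergence, $A_{j,k}\in\mathbb P$), then $M(A_{1,k},\dots,A_{n,k})\to M(A_1,\dots,A_n)$ strongly, and likewise for increasing sequences $A_{j,k}\nearrow A_j\in\mathbb P$; (D) $M(I,\dots,I)=I$. A Kubo–Ando operator mean $\sigma$ is given by its representing function $f_\sigma$ (non-negative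 operator monotone on $[0,\infty)$, $f_\sigma(1)=1$) via $A\sigma B=A^{1/2}f_\sigma(A^{-1/2}BA^{-1/2})A^{1/2}$ for $A,B\in\mathbb P$. $\mathfrak l$ is the left trivial mean $A\mathfrak lB=A$. $\#_r$ ($0\le r\le1$) has representing function $t^r$; $\mathfrak p_{s,r}$ ($s\in[0,1]$, $r\in[-1,1]$) has representing function $(1-s+st^r)^{1/r}$ for $r\ne0$, and $\mathfrak p_{s,0}:=\#_s$. Deformed mean: for $M$ with (A)–(D) and an operator mean $\sigma\ne\mathfrak l$, $M_\sigma(A_1,\dots,A_n)$ is the unique solution $X\in\mathbb P$ (known to exist) of $X=M(X\sigma A_1,\dots,X\sigma A_n)$. *)

theory Defs
  imports "HOL-Analysis.Analysis"
begin

text \<open>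
  A nonzero finite-dimensional Hilbert space is modelled as \<open>complex ^ 'd\<close> with its standard
  inner product, and its operators as square matrices acting by \<open>*v\<close>.  An \<open>n\<close>-tuple of operators
  is a function on a finite index type of cardinality \<open>n\<close>.
\<close>

type_synonym 'd oper = "complex ^ 'd ^ 'd"

definition cinner :: "complex ^ 'd \<Rightarrow> complex ^ 'd \<Rightarrow> complex" where
  "cinner x y = (\<Sum>i\<in>UNIV. cnj (x $ i) * y $ i)"

definition cadjoint :: "('d::finite) oper \<Rightarrow> 'd oper" where
  "cadjoint A = (\<chi> i j. cnj (A $ j $ i))"

definition selfadjoint_op :: "('d::finite) oper \<Rightarrow> bool" where
  "selfadjoint_op A \<longleftrightarrow> cadjoint A = A"

definition unitary_op :: "('d::finite) oper \<Rightarrow> bool" where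
  "unitary_op U \<longleftrightarrow> cadjoint U ** U = mat 1 \<and> U ** cadjoint U = mat 1"

definition positive_op :: "('d::finite) oper \<Rightarrow> bool" where
  "positive_op A \<longleftrightarrow> selfadjoint_op A \<and> (\<forall>x. 0 \<le> Re (cinner x (A *v x)))"

definition op_le :: "('d::finite) oper \<Rightarrow> 'd oper \<Rightarrow> bool"  (infix \<open>\<preceq>\<close> 50) where
  "A \<preceq> B \<longleftrightarrow> positive_op (B - A)"

definition PP :: "('d::finite) oper set" where
  "PP = {A. positive_op A \<and> invertible A}"

definition opnorm :: "('d::finite) oper \<Rightarrow> real" where
  "opnorm A = onorm (\<lambda>x. A *v x)"

definition opnorm_continuous_on :: "'a::topological_space set \<Rightarrow> ('a \<Rightarrow> ('d::finite) oper) \<Rightarrow> bool" where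
  "opnorm_continuous_on S F \<longleftrightarrow>
     (\<forall>p\<in>S. ((\<lambda>q. opnorm (F q - F p)) \<longlongrightarrow> 0) (at p within S))"

definition strongly_tendsto :: "(nat \<Rightarrow> ('d::finite) oper) \<Rightarrow> 'd oper \<Rightarrow> bool" where
  "strongly_tendsto T L \<longleftrightarrow> (\<forall>x. (\<lambda>k. T k *v x) \<longlonglongrightarrow> L *v x)"

definition real_diag :: "('d \<Rightarrow> real) \<Rightarrow> ('d::finite) oper" where
  "real_diag d = (\<chi> i j. if i = j then complex_of_real (d i) else 0)"

text \<open>Functional calculus of a self-adjoint operator; the value does not depend on the chosen
  diagonalization.\<close>

definition fun_calc :: "(real \<Rightarrow> real) \<Rightarrow> ('d::finite) oper \<Rightarrow> 'd oper" where
  "fun_calc f A = (THE B. \<exists>U d. unitary_op U \<and> A = U ** real_diag d ** cadjoint U \<and>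
                                 B = U ** real_diag (\<lambda>i. f (d i)) ** cadjoint U)"

definition op_powr :: "('d::finite) oper \<Rightarrow> real \<Rightarrow> 'd oper" where
  "op_powr A p = fun_calc (\<lambda>t. t powr p) A"

definition op_log :: "('d::finite) oper \<Rightarrow> 'd oper" where
  "op_log A = fun_calc ln A"

text \<open>The Kubo--Ando mean with representing function \<open>f\<close>, on \<open>PP\<close>.  Only the values of \<open>f\<close> on
  \<open>{0<..}\<close> matter here.\<close>

definition ka_mean :: "(real \<Rightarrow> real) \<Rightarrow> ('d::finite) oper \<Rightarrow> 'd oper \<Rightarrow> 'd oper" where
  "ka_mean f A B = op_powr A (1/2) **
     fun_calc f (op_powr A (-1/2) ** B ** op_powr A (-1/2)) ** op_powr A (1/2)"

definition geo_mean :: "real \<Rightarrow> ('d::finite) oper \<Rightarrow> 'd oper \<Rightarrow> 'd oper" where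
  "geo_mean r = ka_mean (\<lambda>t. t powr r)"

definition bin_power_mean :: "real \<Rightarrow> real \<Rightarrow> ('d::finite) oper \<Rightarrow> 'd oper \<Rightarrow> 'd oper" where
  "bin_power_mean s r =
     (if r = 0 then geo_mean s else ka_mean (\<lambda>t. (1 - s + s * t powr r) powr (1 / r)))"

definition weight_vector :: "('n::finite \<Rightarrow> real) \<Rightarrow> bool" where
  "weight_vector w \<longleftrightarrow> (\<forall>j. 0 \<le> w j) \<and> (\<Sum>j\<in>UNIV. w j) = 1"

definition arith_mean :: "('n::finite \<Rightarrow> real) \<Rightarrow> ('n \<Rightarrow> ('d::finite) oper) \<Rightarrow> 'd oper" where
  "arith_mean w A = (\<Sum>j\<in>UNIV. w j *\<^sub>R A j)"

definition harm_mean :: "('n::finite \<Rightarrow> real) \<Rightarrow> ('n \<Rightarrow> ('d::finite) oper) \<Rightarrow> 'd oper" where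
  "harm_mean w A = matrix_inv (\<Sum>j\<in>UNIV. w j *\<^sub>R matrix_inv (A j))"

definition karcher_mean :: "('n::finite \<Rightarrow> real) \<Rightarrow> ('n \<Rightarrow> ('d::finite) oper) \<Rightarrow> 'd oper" where
  "karcher_mean w A = (THE X. X \<in> PP \<and>
     (\<Sum>j\<in>UNIV. w j *\<^sub>R op_log (op_powr X (-1/2) ** A j ** op_powr X (-1/2))) = 0)"

text \<open>The weighted power mean is meaningful for \<open>0 < r \<le> 1\<close> and \<open>-1 \<le> r < 0\<close>.\<close>

definition power_mean :: "('n::finite \<Rightarrow> real) \<Rightarrow> real \<Rightarrow> ('n \<Rightarrow> ('d::finite) oper) \<Rightarrow> 'd oper" where
  "power_mean w r A = (THE X. X \<in> PP \<and>
     X = (if 0 < r then arith_mean w (\<lambda>j. geo_mean r X (A j))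
          else harm_mean w (\<lambda>j. geo_mean (- r) X (A j))))"

definition deformed_mean ::
  "(('n \<Rightarrow> ('d::finite) oper) \<Rightarrow> 'd oper) \<Rightarrow> ('d oper \<Rightarrow> 'd oper \<Rightarrow> 'd oper) \<Rightarrow> ('n \<Rightarrow> 'd oper) \<Rightarrow> 'd oper"
where
  "deformed_mean M \<sigma> A = (THE X. X \<in> PP \<and> X = M (\<lambda>j. \<sigma> X (A j)))"

definition deformed_family ::
  "(('n::finite \<Rightarrow> ('d::finite) oper) \<Rightarrow> 'd oper) \<Rightarrow> ('n \<Rightarrow> real) \<Rightarrow> real \<Rightarrow> real \<Rightarrow> ('n \<Rightarrow> 'd oper) \<Rightarrow> 'd oper"
where
  "deformed_family M w s r =
     (if s \<noteq> 0 then deformed_mean M (bin_power_mean s r)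
      else if r \<noteq> 0 then power_mean w r
      else karcher_mean w)"

definition joint_monotone :: "(('n \<Rightarrow> ('d::finite) oper) \<Rightarrow> 'd oper) \<Rightarrow> bool" where
  "joint_monotone M \<longleftrightarrow>
     (\<forall>A B. (\<forall>j. A j \<in> PP) \<longrightarrow> (\<forall>j. B j \<in> PP) \<longrightarrow> (\<forall>j. A j \<preceq> B j) \<longrightarrow> M A \<preceq> M B)"

definition pos_homogeneous :: "(('n \<Rightarrow> ('d::finite) oper) \<Rightarrow> 'd oper) \<Rightarrow> bool" where
  "pos_homogeneous M \<longleftrightarrow>
     (\<forall>\<alpha> A. 0 < \<alpha> \<longrightarrow> (\<forall>j. A j \<in> PP) \<longrightarrow> M (\<lambda>j. \<alpha> *\<^sub>R A j) = \<alpha> *\<^sub>R M A)"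

definition monotone_continuous :: "(('n \<Rightarrow> ('d::finite) oper) \<Rightarrow> 'd oper) \<Rightarrow> bool" where
  "monotone_continuous M \<longleftrightarrow>
     (\<forall>T A. (\<forall>k j. T k j \<in> PP) \<longrightarrow> (\<forall>j. A j \<in> PP) \<longrightarrow>
            (\<forall>j. strongly_tendsto (\<lambda>k. T k j) (A j)) \<longrightarrow>
            ((\<forall>k j. T (Suc k) j \<preceq> T k j) \<or> (\<forall>k j. T k j \<preceq> T (Suc k) j)) \<longrightarrow>
            strongly_tendsto (\<lambda>k. M (T k)) (M A))"

definition normalized :: "(('n \<Rightarrow> ('d::finite) oper) \<Rightarrow> 'd oper) \<Rightarrow> bool" where
  "normalized M \<longleftrightarrow> M (\<lambda>j. mat 1) = mat 1"

definition between_HA :: "('n::finite \<Rightarrow> real) \<Rightarrow> (('n \<Rightarrow> ('d::finite) oper) \<Rightarrow> 'd oper) \<Rightarrow> bool" where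
  "between_HA w M \<longleftrightarrow>
     (\<forall>A. (\<forall>j. A j \<in> PP) \<longrightarrow> harm_mean w A \<preceq> M A \<and> M A \<preceq> arith_mean w A)"

end

theory Submission
  imports Defs
begin

text \<open>
  For fixed \<open>A\<close> all values of the family solve one system: \<open>X = M (X \<sigma> A\<^sub>j)\<close> with \<open>\<sigma> = p\<^sub>s\<^sub>,\<^sub>r\<close> for \<open>s > 0\<close>, and
  \<open>\<Sum>\<^sub>j w\<^sub>j g\<^sub>r(X\<^sup>-\<^sup>1\<^sup>/\<^sup>2 A\<^sub>j X\<^sup>-\<^sup>1\<^sup>/\<^sup>2) = 0\<close> with \<open>g\<^sub>r(t) = (t\<^sup>r - 1) / r\<close>, \<open>g\<^sub>0 = ln\<close>, for \<open>s = 0\<close>.  If \<open>m \<le> A\<^sub>j \<le> K\<close>, there is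
  a solution in the compact convex order interval \<open>[m, K]\<close>: by Brouwer for \<open>s > 0\<close>, and as a limit
  for \<open>s = 0\<close>.  It is unique: given solutions \<open>X\<close> and \<open>Y\<close>, take the least \<open>\<alpha>\<close> with \<open>X \<le> \<alpha> Y\<close> and a vector
  where equality holds; monotonicity of the means forces \<open>\<alpha> \<le> 1\<close>.  Finally the solution relation
  is closed in \<open>(s, r, X)\<close>.  At \<open>s \<rightarrow> 0\<close> this holds because the representing function is
  \<open>1 + s g\<^sub>r(t) + O(s\<^sup>2)\<close>, so that the bounds of \<open>M\<close> by the harmonic and the arithmetic mean squeeze
  \<open>\<Sum>\<^sub>j w\<^sub>j g\<^sub>r(X\<^sup>-\<^sup>1\<^sup>/\<^sup>2 A\<^sub>j X\<^sup>-\<^sup>1\<^sup>/\<^sup>2)\<close> to \<open>0\<close>.  A closed graph in a compact set gives continuity.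
\<close>

section \<open>Adjoints, order and entries of operators\<close>

text \<open>Every value of the family is a definite description, so existence and uniqueness have to
  be proved before continuity; existence of power and Karcher means falls out of the compactness
  argument. The main obstacle is that Brouwer and uniqueness both need jointly monotone binary
  means, usually drawn from integral representations of operator monotone functions. Here
  monotonicity is built up algebraically: the geometric mean solves a Riccati equation, midpoints
  and limits reach #_r for all r in [0,1], and the power mean with r > 0 solves a fixed point
  equation in terms of #_r; inversion gives r < 0. Both equations are compared at touching vectors.
  Scalar computation is possible because two positive definite operators X and A can be written as T
  T' and T D T', with T invertible, T' its adjoint and D diagonal; a mean of X and A then acts on D
  alone. At s = r = 0 the function ln takes both signs and monotonicity in X is lost, so there only
  values at the touching vector are compared.\<close>

lemma Re_cinner: "Re (cinner x y) = x \<bullet> y"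
  by (simp add: cinner_def inner_vec_def inner_complex_def)

lemma cadjoint_nth [simp]: "cadjoint A $ i $ j = cnj (A $ j $ i)"
  by (simp add: cadjoint_def)

lemma cadjoint_cadjoint [simp]: "cadjoint (cadjoint A) = A"
  by (simp add: vec_eq_iff)

lemma cadjoint_mult: "cadjoint (A ** B) = cadjoint B ** cadjoint A"
  by (simp add: vec_eq_iff matrix_matrix_mult_def mult.commute)

lemma cadjoint_mat_1 [simp]: "cadjoint (mat 1) = mat 1"
  by (auto simp: vec_eq_iff mat_def)

lemma cadjoint_add: "cadjoint (A + B) = cadjoint A + cadjoint B"
  by (simp add: vec_eq_iff)

lemma cadjoint_diff: "cadjoint (A - B) = cadjoint A - cadjoint B"
  by (simp add: vec_eq_iff)

lemma cadjoint_scaleR: "cadjoint (c *\<^sub>R A) = c *\<^sub>R cadjoint A"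
  by (simp add: vec_eq_iff)

lemma cadjoint_real_diag [simp]: "cadjoint (real_diag d) = real_diag d"
  by (auto simp: vec_eq_iff real_diag_def)

lemma cinner_adjoint: "cinner (cadjoint A *v x) y = cinner x (A *v y)"
  unfolding cinner_def matrix_vector_mult_def
  by (simp add: sum_distrib_left sum_distrib_right mult_ac) (subst sum.swap, rule refl)

lemma inner_adjoint: "(cadjoint A *v x) \<bullet> y = x \<bullet> (A *v y)"
  by (metis Re_cinner cinner_adjoint)

lemma real_diag_mult_nth: "(real_diag a ** B) $ i $ j = complex_of_real (a i) * B $ i $ j"
proof -
  have "(real_diag a ** B) $ i $ j = (\<Sum>k\<in>UNIV. if k = i then complex_of_real (a i) * B $ i $ j else 0)"
    unfolding matrix_matrix_mult_def vec_lambda_beta by (rule sum.cong) (auto simp: real_diag_def)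
  then show ?thesis by simp
qed

lemma mult_real_diag_nth: "(B ** real_diag a) $ i $ j = B $ i $ j * complex_of_real (a j)"
proof -
  have "(B ** real_diag a) $ i $ j = (\<Sum>k\<in>UNIV. if k = j then B $ i $ j * complex_of_real (a j) else 0)"
    unfolding matrix_matrix_mult_def vec_lambda_beta by (rule sum.cong) (auto simp: real_diag_def)
  then show ?thesis by simp
qed

lemma real_diag_mult: "real_diag a ** real_diag b = real_diag (\<lambda>i. a i * b i)"
  by (auto simp: vec_eq_iff real_diag_mult_nth) (auto simp: real_diag_def)

lemma real_diag_one: "real_diag (\<lambda>i. 1) = mat 1"
  by (auto simp: vec_eq_iff real_diag_def mat_def)

lemma real_diag_vec: "(real_diag a *v x) $ i = complex_of_real (a i) * x $ i"
  by (simp add: real_diag_def matrix_vector_mult_def if_distrib if_distribR sum.delta cong: if_cong)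

lemma mat_scaleR_left: "(c *\<^sub>R A) ** B = c *\<^sub>R (A ** B)" for A :: "'d::finite oper"
  by (simp add: vec_eq_iff matrix_matrix_mult_def scaleR_sum_right)

lemma mat_scaleR_right: "A ** (c *\<^sub>R B) = c *\<^sub>R (A ** B)" for A :: "'d::finite oper"
  by (simp add: vec_eq_iff matrix_matrix_mult_def scaleR_sum_right)

lemma scaleR_mat_vec: "(c *\<^sub>R A) *v x = c *\<^sub>R (A *v x)" for A :: "'d::finite oper"
  by (simp add: vec_eq_iff matrix_vector_mult_def scaleR_sum_right)

lemma mat_diff_ldistrib: "A ** (B - C) = A ** B - A ** C" for A :: "'d::finite oper"
  by (simp add: vec_eq_iff matrix_matrix_mult_def algebra_simps sum_subtractf)

lemma mat_diff_rdistrib: "(B - C) ** A = B ** A - C ** A" for A :: "'d::finite oper"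
  by (simp add: vec_eq_iff matrix_matrix_mult_def algebra_simps sum_subtractf)

section \<open>Quadratic forms and the Loewner order\<close>

lemma selfadjoint_inner: "selfadjoint_op A \<Longrightarrow> (A *v x) \<bullet> y = x \<bullet> (A *v y)"
  by (metis inner_adjoint selfadjoint_op_def)

lemma positive_op_inner: "positive_op A \<longleftrightarrow> selfadjoint_op A \<and> (\<forall>x. 0 \<le> x \<bullet> (A *v x))"
  by (simp add: positive_op_def Re_cinner)

lemma op_le_iff:
  "A \<preceq> B \<longleftrightarrow> selfadjoint_op (B - A) \<and> (\<forall>x. x \<bullet> (A *v x) \<le> x \<bullet> (B *v x))"
  by (simp add: op_le_def positive_op_inner matrix_vector_mult_diff_rdistrib inner_diff_right)

lemma op_le_inner: "A \<preceq> B \<Longrightarrow> x \<bullet> (A *v x) \<le> x \<bullet> (B *v x)"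
  by (simp add: op_le_iff)

lemma op_le_refl [simp]: "A \<preceq> A"
  by (simp add: op_le_iff selfadjoint_op_def vec_eq_iff)

lemma positive_op_add: "positive_op A \<Longrightarrow> positive_op B \<Longrightarrow> positive_op (A + B)"
  by (simp add: positive_op_inner selfadjoint_op_def cadjoint_add matrix_vector_mult_add_rdistrib
      inner_add_right)

lemma positive_op_scaleR: "positive_op A \<Longrightarrow> 0 \<le> c \<Longrightarrow> positive_op (c *\<^sub>R A)"
  by (simp add: positive_op_inner selfadjoint_op_def cadjoint_scaleR scaleR_mat_vec)

lemma op_le_trans: "A \<preceq> B \<Longrightarrow> B \<preceq> C \<Longrightarrow> A \<preceq> C"
  using positive_op_add[of "B - A" "C - B"] by (simp add: op_le_def)

lemma op_le_add: "A \<preceq> B \<Longrightarrow> C \<preceq> D \<Longrightarrow> A + C \<preceq> B + D"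
  using positive_op_add[of "B - A" "D - C"] by (simp add: op_le_def algebra_simps)

lemma op_le_scaleR: "A \<preceq> B \<Longrightarrow> 0 \<le> c \<Longrightarrow> c *\<^sub>R A \<preceq> c *\<^sub>R B"
  using positive_op_scaleR[of "B - A" c] by (simp add: op_le_def scaleR_diff_right)

lemma op_le_sum: "(\<And>j. j \<in> J \<Longrightarrow> A j \<preceq> B j) \<Longrightarrow> (\<Sum>j\<in>J. A j) \<preceq> (\<Sum>j\<in>J. B j)"
  by (induction J rule: infinite_finite_induct) (auto intro: op_le_add)

lemma op_le_diff_iff: "A \<preceq> B \<longleftrightarrow> 0 \<preceq> B - A"
  by (simp add: op_le_def)

lemma inner_congruence: "x \<bullet> ((T ** A ** cadjoint T) *v x) = (cadjoint T *v x) \<bullet> (A *v (cadjoint T *v x))"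
  by (simp add: inner_adjoint matrix_vector_mul_assoc flip: matrix_mul_assoc)

lemma positive_op_congruence: "positive_op A \<Longrightarrow> positive_op (T ** A ** cadjoint T)"
  by (simp add: positive_op_inner inner_congruence selfadjoint_op_def cadjoint_mult matrix_mul_assoc)

lemma op_le_congruence: "A \<preceq> B \<Longrightarrow> T ** A ** cadjoint T \<preceq> T ** B ** cadjoint T"
  using positive_op_congruence[of "B - A" T]
  by (simp add: op_le_def mat_diff_ldistrib mat_diff_rdistrib)

lemma selfadjoint_op_le: "A \<preceq> B \<Longrightarrow> selfadjoint_op A \<Longrightarrow> selfadjoint_op B"
  unfolding op_le_iff selfadjoint_op_def cadjoint_diff by simp

text \<open>Polarization and the parallelogram law bound the real bilinear form by \<open>c\<close>
  on unit vectors. Testing against \<open>axis i 1\<close> and its imaginary multiple gives the real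
  and the imaginary part of the entry, whence the factor 2.\<close>

lemma selfadjoint_entry_bound:
  assumes "selfadjoint_op H" "\<And>x. \<bar>x \<bullet> (H *v x)\<bar> \<le> c * (norm x)\<^sup>2"
  shows "norm (H $ i $ j) \<le> 2 * c"
proof -
  have *: "\<bar>x \<bullet> (H *v y)\<bar> \<le> c" if "norm x = 1" "norm y = 1" for x y
  proof -
    have "4 * (x \<bullet> (H *v y)) = (x + y) \<bullet> (H *v (x + y)) - (x - y) \<bullet> (H *v (x - y))"
      using selfadjoint_inner[OF assms(1), of y x]
      by (simp add: algebra_simps inner_commute)
    moreover have "(norm (x + y))\<^sup>2 + (norm (x - y))\<^sup>2 = 4"
      using that by (simp add: power2_norm_eq_inner algebra_simps norm_eq_1)
    then have "c * (norm (x + y))\<^sup>2 + c * (norm (x - y))\<^sup>2 = 4 * c"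
      by (metis distrib_left mult.commute)
    ultimately show ?thesis
      using assms(2)[of "x+y"] assms(2)[of "x-y"] by linarith
  qed
  have e: "(H *v axis j 1) $ i = H $ i $ j"
    by (simp add: matrix_vector_mult_def axis_def if_distrib cong: if_cong)
  have "\<bar>Re (H $ i $ j)\<bar> \<le> c"
    using *[of "axis i 1" "axis j 1"] by (simp add: norm_eq_1 inner_axis_axis inner_axis' e inner_complex_def)
  moreover have "\<bar>Im (H $ i $ j)\<bar> \<le> c"
    using *[of "axis i \<i>" "axis j 1"] by (simp add: norm_eq_1 inner_axis_axis inner_axis' e inner_complex_def)
  ultimately show ?thesis
    using cmod_le[of "H $ i $ j"] by linarith
qed

lemma op_le_antisym:
  assumes "A \<preceq> B" "B \<preceq> A" shows "A = B"
proof -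
  have "norm ((B - A) $ i $ j) \<le> 2 * 0" for i j
  proof (rule selfadjoint_entry_bound)
    show "selfadjoint_op (B - A)"
      using assms(1) by (simp add: op_le_iff)
    show "\<bar>x \<bullet> ((B - A) *v x)\<bar> \<le> 0 * (norm x)\<^sup>2" for x
      using op_le_inner[OF assms(1), of x] op_le_inner[OF assms(2), of x]
      by (simp add: matrix_vector_mult_diff_rdistrib inner_diff_right)
  qed
  then show ?thesis by (simp add: vec_eq_iff)
qed

section \<open>Entry sums as norm bounds, and limits of operators\<close>

lemma norm_matrix_vector_le: "norm (A *v x) \<le> (\<Sum>i\<in>UNIV. \<Sum>j\<in>UNIV. norm (A $ i $ j)) * norm x"
  for A :: "'d::finite oper"
proof -
  have "norm (A *v x) \<le> (\<Sum>i\<in>UNIV. norm ((A *v x) $ i))"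
    by (simp add: norm_le_l1_cart L2_set_le_sum norm_vec_def)
  also have "\<dots> \<le> (\<Sum>i\<in>UNIV. \<Sum>j\<in>UNIV. norm (A $ i $ j) * norm x)"
    unfolding matrix_vector_mult_def
    by (auto intro!: sum_mono order_trans[OF norm_sum] mult_left_mono
        simp: norm_mult Finite_Cartesian_Product.norm_nth_le)
  finally show ?thesis by (simp add: sum_distrib_right)
qed

lemma opnorm_le: "opnorm A \<le> (\<Sum>i\<in>UNIV. \<Sum>j\<in>UNIV. norm (A $ i $ j))"
  unfolding opnorm_def by (rule onorm_le) (rule norm_matrix_vector_le)

lemma inner_matrix_vector_le:
  "\<bar>x \<bullet> (A *v x)\<bar> \<le> (\<Sum>i\<in>UNIV. \<Sum>j\<in>UNIV. norm (A $ i $ j)) * (norm x)\<^sup>2"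
  for A :: "'d::finite oper"
proof -
  have "\<bar>x \<bullet> (A *v x)\<bar> \<le> norm x * norm (A *v x)"
    by (rule Cauchy_Schwarz_ineq2)
  also have "\<dots> \<le> norm x * ((\<Sum>i\<in>UNIV. \<Sum>j\<in>UNIV. norm (A $ i $ j)) * norm x)"
    by (intro mult_left_mono norm_matrix_vector_le) auto
  finally show ?thesis by (simp add: power2_eq_square mult_ac)
qed

lemma tendsto_matrix_mult [tendsto_intros]:
  fixes A B :: "'a \<Rightarrow> 'd::finite oper"
  assumes "(A \<longlongrightarrow> a) F" "(B \<longlongrightarrow> b) F"
  shows "((\<lambda>k. A k ** B k) \<longlongrightarrow> a ** b) F"
  unfolding matrix_matrix_mult_def using assms by (intro tendsto_intros)

lemma tendsto_matrix_vector [tendsto_intros]: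
  fixes A :: "'a \<Rightarrow> 'd::finite oper"
  assumes "(A \<longlongrightarrow> a) F"
  shows "((\<lambda>k. A k *v x) \<longlongrightarrow> a *v x) F"
  unfolding matrix_vector_mult_def using assms by (intro tendsto_intros)

lemma tendsto_cadjoint [tendsto_intros]:
  assumes "(A \<longlongrightarrow> a) F"
  shows "((\<lambda>k. cadjoint (A k)) \<longlongrightarrow> cadjoint a) F"
  unfolding cadjoint_def using assms by (intro tendsto_intros)

lemma tendsto_real_diag [tendsto_intros]:
  assumes "\<And>i. ((\<lambda>k. d k i) \<longlongrightarrow> e i) F"
  shows "((\<lambda>k. real_diag (d k)) \<longlongrightarrow> real_diag e) F"
  unfolding real_diag_def
proof (intro tendsto_vec_lambda)
  fix i j :: 'a
  show "((\<lambda>k. if i = j then complex_of_real (d k i) else 0) \<longlongrightarrow> (if i = j then complex_of_real (e i) else 0)) F"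
    using assms[of i] by (cases "i = j") (auto intro: tendsto_intros)
qed

lemma op_le_tendsto:
  assumes "(A \<longlongrightarrow> a) F" "(B \<longlongrightarrow> b) F" "eventually (\<lambda>k. A k \<preceq> B k) F" "F \<noteq> bot"
  shows "a \<preceq> b"
  unfolding op_le_iff selfadjoint_op_def
proof (intro conjI allI)
  have "((\<lambda>k. cadjoint (B k - A k)) \<longlongrightarrow> cadjoint (b - a)) F" "((\<lambda>k. B k - A k) \<longlongrightarrow> b - a) F"
    using assms by (auto intro!: tendsto_intros)
  moreover have "eventually (\<lambda>k. cadjoint (B k - A k) = B k - A k) F"
    using assms(3) by eventually_elim (simp add: op_le_iff selfadjoint_op_def)
  ultimately have "((\<lambda>k. B k - A k) \<longlongrightarrow> cadjoint (b - a)) F" "((\<lambda>k. B k - A k) \<longlongrightarrow> b - a) F"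
    by (simp_all add: tendsto_cong)
  then show "cadjoint (b - a) = b - a"
    by (rule tendsto_unique[OF assms(4)])
next
  fix x
  have "eventually (\<lambda>k. x \<bullet> (A k *v x) \<le> x \<bullet> (B k *v x)) F"
    using assms(3) by eventually_elim (rule op_le_inner)
  moreover have "((\<lambda>k. x \<bullet> (A k *v x)) \<longlongrightarrow> x \<bullet> (a *v x)) F" "((\<lambda>k. x \<bullet> (B k *v x)) \<longlongrightarrow> x \<bullet> (b *v x)) F"
    using assms by (auto intro!: tendsto_intros)
  ultimately show "x \<bullet> (a *v x) \<le> x \<bullet> (b *v x)"
    using tendsto_le[OF assms(4)] by blast
qed

section \<open>Spectral theorem and simultaneous diagonalization\<close>

lemma cinner_self: "cinner x x = complex_of_real (x \<bullet> x)"
  by (simp add: cinner_def inner_vec_def inner_complex_def complex_eq_iff power2_eq_square)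

lemma cinner_commute: "cinner y x = cnj (cinner x y)"
  by (simp add: cinner_def mult.commute)

lemma cinner_add_right: "cinner x (y + z) = cinner x y + cinner x z"
  by (simp add: cinner_def algebra_simps sum.distrib)

lemma cinner_diff_right: "cinner x (y - z) = cinner x y - cinner x z"
  by (simp add: cinner_def algebra_simps sum_subtractf)

lemma cinner_scaleR_right: "cinner x (c *\<^sub>R y) = c *\<^sub>R cinner x y"
  by (simp add: cinner_def scaleR_sum_right)

lemma cinner_scaleR_left: "cinner (c *\<^sub>R x) y = c *\<^sub>R cinner x y"
  by (simp add: cinner_def scaleR_sum_right)

lemma mat_vec_scaleR: "A *v (c *\<^sub>R x) = c *\<^sub>R (A *v x)" for A :: "'d::finite oper"
  by (simp add: vec_eq_iff matrix_vector_mult_def scaleR_sum_right)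

text \<open>Dimension is counted over the reals: complex orthogonality to \<open>v j\<close> is real
  orthogonality to \<open>v j\<close> and to its imaginary multiple, which makes at most
  \<open>2 * card J\<close> conditions in real dimension \<open>2 * CARD('d)\<close>.\<close>

lemma nonzero_orthogonal_exists:
  fixes v :: "'d::finite \<Rightarrow> complex ^ 'd"
  assumes "J \<noteq> UNIV"
  obtains z where "z \<noteq> 0" "\<And>j. j \<in> J \<Longrightarrow> cinner (v j) z = 0"
proof -
  let ?B = "v ` J \<union> (\<lambda>j. \<i> *s v j) ` J"
  have "dim ?B \<le> card ?B"
    by (rule dim_le_card) (auto simp: span_superset)
  also have "\<dots> \<le> card (v ` J) + card ((\<lambda>j. \<i> *s v j) ` J)"
    by (rule card_Un_le)
  also have "\<dots> \<le> card J + card J"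
    by (intro add_mono card_image_le) auto
  also have "\<dots> < DIM(complex ^ 'd)"
    using assms psubset_card_mono[of UNIV J] by (simp add: psubset_eq)
  finally obtain z :: "complex ^ 'd" where z: "z \<noteq> 0" "\<And>y. y \<in> span ?B \<Longrightarrow> orthogonal z y"
    using orthogonal_to_subspace_exists by blast
  have "cinner (v j) z = 0" if "j \<in> J" for j
  proof -
    have "v j \<bullet> z = 0" "(\<i> *s v j) \<bullet> z = 0"
      using z(2)[of "v j"] z(2)[of "\<i> *s v j"] that
      by (auto simp: orthogonal_def inner_commute span_base)
    moreover have "(\<i> *s v j) \<bullet> z = Im (cinner (v j) z)"
      by (simp add: cinner_def flip: Re_cinner)
    ultimately show ?thesis
      by (simp add: complex_eq_iff Re_cinner)
  qed
  with z(1) show thesis by (rule that)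
qed

text \<open>A unit vector maximizing the quadratic form on an invariant subspace is an eigenvector.\<close>

lemma orthogonal_eigenvector_exists:
  fixes v :: "'d::finite \<Rightarrow> complex ^ 'd"
  assumes A: "selfadjoint_op A" and J: "J \<noteq> UNIV" and ev: "\<And>j. j \<in> J \<Longrightarrow> A *v v j = c j *\<^sub>R v j"
  shows "\<exists>x l. norm x = 1 \<and> A *v x = l *\<^sub>R x \<and> (\<forall>j\<in>J. cinner (v j) x = 0)"
proof -
  define W where "W = {x. \<forall>j\<in>J. cinner (v j) x = 0}"
  have sc: "c *\<^sub>R x \<in> W" if "x \<in> W" for x c
    using that by (simp add: W_def cinner_scaleR_right)
  have di: "x - y \<in> W" "x + y \<in> W" if "x \<in> W" "y \<in> W" for x y
    using that by (simp_all add: W_def cinner_diff_right cinner_add_right)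
  have AW: "A *v x \<in> W" if "x \<in> W" for x
  proof -
    have "cinner (v j) (A *v x) = cinner (A *v v j) x" for j
      using A by (metis cinner_adjoint selfadjoint_op_def)
    then show ?thesis using that by (simp add: W_def ev cinner_scaleR_left)
  qed
  obtain z where "z \<noteq> 0" "\<And>j. j \<in> J \<Longrightarrow> cinner (v j) z = 0"
    by (rule nonzero_orthogonal_exists[OF J, of v]) blast
  then have z: "z \<noteq> 0" "z \<in> W" by (auto simp: W_def)
  have "closed {x. cinner (v j) x = 0}" for j
    unfolding cinner_def by (intro closed_Collect_eq continuous_intros)
  moreover have "W = (\<Inter>j\<in>J. {x. cinner (v j) x = 0})"
    by (auto simp: W_def)
  ultimately have "closed W" by auto
  then have "compact (sphere 0 1 \<inter> W)"
    by (intro compact_Int_closed) auto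
  moreover have "inverse (norm z) *\<^sub>R z \<in> sphere 0 1 \<inter> W"
    using z sc by simp
  moreover have "continuous_on (sphere 0 1 \<inter> W) (\<lambda>x. x \<bullet> (A *v x))"
    by (intro continuous_intros linear_continuous_on matrix_vector_mul_bounded_linear)
  ultimately obtain x where x: "x \<in> sphere 0 1 \<inter> W"
    and max: "\<And>y. y \<in> sphere 0 1 \<inter> W \<Longrightarrow> y \<bullet> (A *v y) \<le> x \<bullet> (A *v x)"
    using continuous_attains_sup[of "sphere 0 1 \<inter> W" "\<lambda>x. x \<bullet> (A *v x)"] by blast
  define l where "l = x \<bullet> (A *v x)"
  \<comment> \<open>\<open>q\<close> vanishes at the maximizer \<open>x\<close> and is non-negative
    on \<open>W\<close>, so \<open>x\<close> minimizes it there.\<close>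
  define q where "q y = l * (y \<bullet> y) - y \<bullet> (A *v y)" for y
  have q_ge: "0 \<le> q y" if "y \<in> W" for y
  proof (cases "y = 0")
    case False
    let ?u = "inverse (norm y) *\<^sub>R y"
    have "?u \<bullet> (A *v ?u) \<le> l"
      using max[of ?u] that sc False by (simp add: l_def)
    moreover have "?u \<bullet> (A *v ?u) = (y \<bullet> (A *v y)) / (y \<bullet> y)"
      by (simp add: mat_vec_scaleR divide_inverse power2_norm_eq_inner[symmetric]
          power2_eq_square)
    ultimately show ?thesis
      using False by (simp add: q_def divide_le_eq)
  qed (simp add: q_def)
  \<comment> \<open>The residual of the eigenvalue equation. Along it \<open>q\<close> has slope 2
    |y|^2 at \<open>x\<close>, so a nonzero residual would allow a step to negative values.\<close>
  define y where "y = l *\<^sub>R x - A *v x"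
  have yW: "y \<in> W"
    unfolding y_def using x by (intro di sc AW) auto
  have xx: "x \<bullet> x = 1"
    using x by (simp add: norm_eq_1)
  have quad: "q (x + t *\<^sub>R y) = 2 * t * (y \<bullet> y) + t\<^sup>2 * q y" for t
  proof -
    have "y \<bullet> y = l * (x \<bullet> y) - y \<bullet> (A *v x)"
      by (simp add: y_def algebra_simps inner_commute)
    moreover have "x \<bullet> (A *v y) = y \<bullet> (A *v x)"
      using selfadjoint_inner[OF A] by (metis inner_commute)
    moreover have "q x = 0" by (simp add: q_def xx l_def)
    moreover have "q (x + t *\<^sub>R y) =
        q x + t * (2 * (l * (x \<bullet> y)) - x \<bullet> (A *v y) - y \<bullet> (A *v x)) + t\<^sup>2 * q y"
      by (simp add: q_def mat_vec_scaleR algebra_simps power2_eq_square inner_commute)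
    ultimately show ?thesis by simp
  qed
  have "y = 0"
  proof (rule ccontr)
    assume "y \<noteq> 0"
    \<comment> \<open>This step length collapses q(x + t y) to t |y|^2 - t^2; the summand 1 keeps
      the denominator positive even if \<open>q y\<close> is 0.\<close>
    define t where "t = - (y \<bullet> y) / (1 + q y)"
    have N: "0 < y \<bullet> y" and Q: "0 \<le> q y" using \<open>y \<noteq> 0\<close> q_ge[OF yW] by auto
    have "t * (1 + q y) = - (y \<bullet> y)" "t < 0"
      using N Q by (simp_all add: t_def divide_less_0_iff)
    then have "t\<^sup>2 * q y = - t * (y \<bullet> y) - t\<^sup>2"
      by (simp add: power2_eq_square algebra_simps) (metis add.commute distrib_left mult_minus_right)
    then have "q (x + t *\<^sub>R y) = t * (y \<bullet> y) - t\<^sup>2"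
      unfolding quad by simp
    also have "\<dots> < 0"
      using N \<open>t < 0\<close> mult_neg_pos[of t "y \<bullet> y"] by (simp add: add_neg_nonpos diff_conv_add_uminus del: add_uminus_conv_diff)
    finally show False
      using q_ge[OF di(2)[OF _ sc[OF yW]], of x t] x by auto
  qed
  then show ?thesis
    using x by (intro exI[of _ x] exI[of _ l]) (auto simp: y_def W_def)
qed

text \<open>Induction over subsets of the index type, each new eigenvector being orthogonal to the
  earlier ones, avoids restricting \<open>A\<close> to invariant subspaces. For
  \<open>J = UNIV\<close> the vectors are the columns of a unitary.\<close>

lemma orthonormal_eigenvectors_exist:
  fixes A :: "'d::finite oper"
  assumes A: "selfadjoint_op A"
  shows "\<exists>(v :: 'd \<Rightarrow> complex ^ 'd) c. (\<forall>i\<in>J. \<forall>j\<in>J. cinner (v i) (v j) = (if i = j then 1 else 0)) \<and>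
               (\<forall>j\<in>J. A *v v j = c j *\<^sub>R v j)"
proof -
  have "finite J" by simp
  then show ?thesis
  proof (induction J rule: finite_induct)
    case (insert i J)
    then obtain v c where on: "\<And>i j. i \<in> J \<Longrightarrow> j \<in> J \<Longrightarrow> cinner (v i) (v j) = (if i = j then 1 else 0)"
      and ev: "\<And>j. j \<in> J \<Longrightarrow> A *v v j = c j *\<^sub>R v j"
      by blast
    have "J \<noteq> UNIV" using insert by auto
    then obtain x l where x: "norm x = 1" "A *v x = l *\<^sub>R x" "\<And>j. j \<in> J \<Longrightarrow> cinner (v j) x = 0"
      using orthogonal_eigenvector_exists[OF A, of J v c] ev by blast
    have "cinner x x = 1" using x(1) by (simp add: cinner_self norm_eq_1)
    moreover have "cinner x (v j) = 0" if "j \<in> J" for j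
      using x(3)[OF that] by (simp add: cinner_commute[of x])
    moreover have "j \<noteq> i" if "j \<in> J" for j using that insert by auto
    ultimately show ?case
      using on ev x by (intro exI[of _ "v(i := x)"] exI[of _ "c(i := l)"]) auto
  qed auto
qed

section \<open>Unitary diagonalization and the functional calculus\<close>

lemma mult_cancel_left: "A ** B = mat 1 \<Longrightarrow> A ** (B ** Y) = Y" for A :: "'d::finite oper"
  by (simp add: matrix_mul_assoc)

lemma unitary_opI: "cadjoint U ** U = mat 1 \<Longrightarrow> unitary_op U"
  by (simp add: unitary_op_def matrix_left_right_inverse)

lemma unitary_simps:
  assumes "unitary_op U"
  shows "cadjoint U ** U = mat 1" "U ** cadjoint U = mat 1"
    "cadjoint U ** (U ** Y) = Y" "U ** (cadjoint U ** Y) = Y"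
  using assms by (simp_all add: unitary_op_def mult_cancel_left)

text \<open>\<open>T\<close> is arbitrary: unitary in spectral decompositions, merely invertible in
  the simultaneous diagonalization of two operators by congruence.\<close>

definition congd :: "'d::finite oper \<Rightarrow> ('d \<Rightarrow> real) \<Rightarrow> 'd oper" where
  "congd T a = T ** real_diag a ** cadjoint T"

theorem spectral_theorem:
  fixes A :: "'d::finite oper"
  assumes "selfadjoint_op A"
  obtains U d where "unitary_op U" "A = congd U d"
proof -
  obtain v :: "'d \<Rightarrow> complex ^ 'd" and c where on: "\<And>i j. cinner (v i) (v j) = (if i = j then 1 else 0)"
    and ev: "\<And>j. A *v v j = c j *\<^sub>R v j"
    using orthonormal_eigenvectors_exist[OF assms, of UNIV] by blast
  define U :: "'d oper" where "U = (\<chi> k j. v j $ k)"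
  have "cadjoint U ** U = mat 1"
    using on by (simp add: vec_eq_iff matrix_matrix_mult_def U_def mat_def cinner_def)
  then have U: "unitary_op U" by (rule unitary_opI)
  have "(A ** U) $ k $ j = (A *v v j) $ k" for k j
    by (simp add: matrix_matrix_mult_def matrix_vector_mult_def U_def)
  then have "A ** U = U ** real_diag c"
    by (simp add: vec_eq_iff mult_real_diag_nth ev) (simp add: U_def scaleR_conv_of_real mult.commute)
  then have "A = U ** real_diag c ** cadjoint U"
    by (metis U matrix_mul_assoc matrix_mul_rid unitary_op_def)
  with U that show thesis by (auto simp: congd_def)
qed

text \<open>\<open>W\<close> intertwines the two diagonals, so \<open>W $ i $ j\<close> is zero
  unless \<open>d j = e i\<close>; hence it also intertwines their images under \<open>f\<close>.
  This makes the description in \<open>fun_calc\<close> well defined.\<close>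

lemma congd_fun_unique:
  assumes U: "unitary_op U" and V: "unitary_op V" and eq: "congd U d = congd V e"
  shows "congd U (\<lambda>i. f (d i)) = congd V (\<lambda>i. f (e i))"
proof -
  define W where "W = cadjoint V ** U"
  have "W ** real_diag d = cadjoint V ** congd U d ** U"
    by (simp add: W_def congd_def matrix_mul_assoc[symmetric] unitary_simps[OF U])
  also have "\<dots> = real_diag e ** W"
    unfolding eq by (simp add: W_def congd_def matrix_mul_assoc[symmetric] unitary_simps[OF V])
  finally have W: "W $ i $ j * complex_of_real (d j) = complex_of_real (e i) * W $ i $ j" for i j
    by (simp add: vec_eq_iff real_diag_mult_nth mult_real_diag_nth)
  have "W $ i $ j * complex_of_real (f (d j)) = complex_of_real (f (e i)) * W $ i $ j" for i j
    using W[of i j] by (cases "W $ i $ j = 0") auto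
  then have *: "W ** real_diag (\<lambda>i. f (d i)) = real_diag (\<lambda>i. f (e i)) ** W"
    by (simp add: vec_eq_iff real_diag_mult_nth mult_real_diag_nth)
  have "congd U (\<lambda>i. f (d i)) = V ** (W ** real_diag (\<lambda>i. f (d i))) ** cadjoint U"
    by (simp add: W_def congd_def matrix_mul_assoc[symmetric] unitary_simps[OF V])
  also have "\<dots> = congd V (\<lambda>i. f (e i))"
    unfolding * by (simp add: W_def congd_def matrix_mul_assoc[symmetric] unitary_simps[OF U])
  finally show ?thesis .
qed

lemma fun_calc_congd:
  assumes "unitary_op U"
  shows "fun_calc f (congd U d) = congd U (\<lambda>i. f (d i))"
  unfolding fun_calc_def congd_def[symmetric]
proof (rule the_equality)
  show "\<exists>V e. unitary_op V \<and> congd U d = congd V e \<and> congd U (\<lambda>i. f (d i)) = congd V (\<lambda>i. f (e i))"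
    using assms by blast
next
  fix B assume "\<exists>V e. unitary_op V \<and> congd U d = congd V e \<and> B = congd V (\<lambda>i. f (e i))"
  then obtain V e where "unitary_op V" "congd U d = congd V e" and B: "B = congd V (\<lambda>i. f (e i))"
    by blast
  from congd_fun_unique[OF assms this(1,2), of f] show "B = congd U (\<lambda>i. f (d i))"
    by (simp add: B)
qed

lemma congd_mult_left: "congd (S ** T) a = S ** congd T a ** cadjoint S"
  by (simp add: congd_def cadjoint_mult matrix_mul_assoc)

lemma congd_scaleR: "c *\<^sub>R congd T a = congd T (\<lambda>i. c * a i)"
proof -
  have "c *\<^sub>R real_diag a = real_diag (\<lambda>i. c * a i)"
    by (auto simp: vec_eq_iff real_diag_def complex_eq_iff)
  then show ?thesis by (metis congd_def mat_scaleR_left mat_scaleR_right)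
qed

lemma mat_add_rdistrib: "(B + C) ** A = B ** A + C ** A" for A :: "'d::finite oper"
  by (simp add: vec_eq_iff matrix_matrix_mult_def algebra_simps sum.distrib)

lemma congd_add: "congd T a + congd T b = congd T (\<lambda>i. a i + b i)"
proof -
  have "real_diag a + real_diag b = real_diag (\<lambda>i. a i + b i)"
    by (auto simp: vec_eq_iff real_diag_def)
  then show ?thesis by (simp add: congd_def flip: mat_add_rdistrib matrix_add_ldistrib)
qed

lemma congd_diff: "congd T a - congd T b = congd T (\<lambda>i. a i - b i)"
  using congd_add[of T "\<lambda>i. a i - b i" b] by (simp add: algebra_simps)

lemma selfadjoint_congd: "selfadjoint_op (congd T a)"
  by (simp add: selfadjoint_op_def congd_def cadjoint_mult matrix_mul_assoc)

lemma congd_inner: "x \<bullet> (congd T a *v x) = (\<Sum>i\<in>UNIV. a i * (norm ((cadjoint T *v x) $ i))\<^sup>2)"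
proof -
  have "z \<bullet> (real_diag a *v z) = (\<Sum>i\<in>UNIV. a i * (norm (z $ i))\<^sup>2)" for z
    by (simp add: inner_vec_def real_diag_vec inner_complex_def cmod_power2) (simp add: power2_eq_square algebra_simps)
  then show ?thesis by (simp add: congd_def inner_congruence)
qed

section \<open>Inverses, dual bases and positive definite operators\<close>

lemma matrix_inv_mult:
  fixes A :: "'d::finite oper"
  assumes "invertible A"
  shows "matrix_inv A ** A = mat 1" "A ** matrix_inv A = mat 1"
  using someI_ex[OF assms[unfolded invertible_def]] by (auto simp: matrix_inv_def)

lemma matrix_inv_eqI:
  fixes A B :: "'d::finite oper"
  assumes "A ** B = mat 1"
  shows "matrix_inv A = B"
proof -
  have "invertible A"
    using assms by (auto simp: invertible_right_inverse)
  then show ?thesis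
    using assms by (metis matrix_inv_mult(1) matrix_mul_assoc matrix_mul_lid matrix_mul_rid)
qed

text \<open>For invertible \<open>T\<close> the columns of this contragredient form the basis dual
  to the columns of \<open>T\<close>. They pick out single coefficients of \<open>congd T a\<close>,
  and \<open>dual T\<close> diagonalizes its inverse.\<close>

definition dual :: "'d::finite oper \<Rightarrow> 'd oper" where
  "dual T = cadjoint (matrix_inv T)"

lemma dual_simps:
  assumes "invertible T"
  shows "cadjoint T ** dual T = mat 1" "dual T ** cadjoint T = mat 1"
    "T ** cadjoint (dual T) = mat 1" "cadjoint (dual T) ** T = mat 1"
    "cadjoint T ** (dual T ** Y) = Y" "dual T ** (cadjoint T ** Y) = Y"
    "T ** (cadjoint (dual T) ** Y) = Y" "cadjoint (dual T) ** (T ** Y) = Y"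
proof -
  show "cadjoint T ** dual T = mat 1" "dual T ** cadjoint T = mat 1"
    "T ** cadjoint (dual T) = mat 1" "cadjoint (dual T) ** T = mat 1"
    using matrix_inv_mult[OF assms] by (simp_all add: dual_def flip: cadjoint_mult)
  then show "cadjoint T ** (dual T ** Y) = Y" "dual T ** (cadjoint T ** Y) = Y"
    "T ** (cadjoint (dual T) ** Y) = Y" "cadjoint (dual T) ** (T ** Y) = Y"
    by (simp_all add: mult_cancel_left)
qed

lemma invertible_dual: "invertible T \<Longrightarrow> invertible (dual T)"
  unfolding invertible_def[of "dual T"] using dual_simps by blast

lemma dual_axis: "invertible T \<Longrightarrow> cadjoint T *v (dual T *v x) = x"
  by (simp add: matrix_vector_mul_assoc dual_simps)

lemma dual_axis_nonzero: "invertible T \<Longrightarrow> dual T *v axis i 1 \<noteq> 0"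
  using dual_axis[of T "axis i 1"] by (metis axis_eq_0_iff matrix_vector_mult_0_right one_neq_zero)

lemma congd_inner_dual_axis:
  fixes T :: "'d::finite oper"
  assumes "invertible T"
  shows "(dual T *v axis i 1) \<bullet> (congd T a *v (dual T *v axis i 1)) = a i"
proof -
  have "(\<Sum>j\<in>UNIV. a j * (norm ((axis i 1 :: complex^'d) $ j))\<^sup>2) = (\<Sum>j\<in>UNIV. if j = i then a i else 0)"
    by (rule sum.cong) (auto simp: axis_def)
  then show ?thesis by (simp add: congd_inner dual_axis[OF assms])
qed

text \<open>Dual basis vectors isolate the coefficients one at a time; conversely, the quadratic
  form is a sum of coefficients with non-negative factors. A common \<open>T\<close> thus turns
  operator inequalities into scalar ones.\<close>

lemma congd_le_iff:
  assumes "invertible T"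
  shows "congd T a \<preceq> congd T b \<longleftrightarrow> (\<forall>i. a i \<le> b i)"
proof
  assume le: "congd T a \<preceq> congd T b"
  show "\<forall>i. a i \<le> b i"
  proof
    fix i
    show "a i \<le> b i"
      using op_le_inner[OF le, of "dual T *v axis i 1"] by (simp add: congd_inner_dual_axis[OF assms])
  qed
next
  assume "\<forall>i. a i \<le> b i"
  then show "congd T a \<preceq> congd T b"
    by (simp add: op_le_iff congd_diff selfadjoint_congd congd_inner sum_mono mult_right_mono)
qed

lemma congd_one: "congd T (\<lambda>i. 1) = T ** cadjoint T"
  by (simp add: congd_def real_diag_one)

lemma matrix_inv_congd:
  fixes T :: "'d::finite oper"
  assumes "invertible T" "\<And>i. a i \<noteq> 0"
  shows "congd T a ** congd (dual T) (\<lambda>i. 1 / a i) = mat 1"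
    "matrix_inv (congd T a) = congd (dual T) (\<lambda>i. 1 / a i)"
proof -
  have "real_diag a ** (real_diag (\<lambda>i. 1 / a i) ** Y) = Y" for Y :: "'d oper"
    using assms(2) by (simp add: matrix_mul_assoc real_diag_mult real_diag_one)
  then show "congd T a ** congd (dual T) (\<lambda>i. 1 / a i) = mat 1"
    by (simp add: congd_def matrix_mul_assoc[symmetric] dual_simps[OF assms(1)])
  then show "matrix_inv (congd T a) = congd (dual T) (\<lambda>i. 1 / a i)"
    by (rule matrix_inv_eqI)
qed

lemma congd_PP:
  assumes "invertible T" "\<And>i. 0 < a i"
  shows "congd T a \<in> PP"
proof -
  have "invertible (congd T a)"
    using matrix_inv_congd(1)[of T a] assms by (metis invertible_right_inverse less_irrefl)
  then show ?thesis
    using assms(2) by (simp add: PP_def positive_op_inner selfadjoint_congd congd_inner sum_nonneg less_imp_le)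
qed

lemma invertible_unitary: "unitary_op U \<Longrightarrow> invertible U"
  unfolding invertible_def unitary_op_def by blast

lemma PP_spectral:
  assumes "A \<in> PP"
  obtains U d where "unitary_op U" "\<And>i. 0 < d i" "A = congd U d"
proof -
  obtain U d where U: "unitary_op U" and A: "A = congd U d"
    using spectral_theorem[of A] assms by (auto simp: PP_def positive_op_def)
  have "congd U (\<lambda>i. 0) \<preceq> congd U d"
    using assms by (simp add: PP_def A op_le_def congd_diff)
  then have "0 \<le> d i" for i
    using congd_le_iff[OF invertible_unitary[OF U], of "\<lambda>i. 0" d] by simp
  \<comment> \<open>A zero eigenvalue would put \<open>U *v axis i 1\<close> into the kernel of the
    invertible \<open>A\<close>.\<close>
  moreover have "d i \<noteq> 0" for i
  proof
    assume "d i = 0"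
    have "U *v axis i 1 \<noteq> 0"
      using inj_matrix_vector_mult[OF invertible_unitary[OF U]]
      by (metis axis_eq_0_iff injD matrix_vector_mult_0_right one_neq_zero)
    moreover have "real_diag d *v axis i 1 = 0"
      using \<open>d i = 0\<close> by (simp add: vec_eq_iff real_diag_vec axis_def)
    then have "A *v (U *v axis i 1) = 0"
      by (simp add: A congd_def matrix_vector_mul_assoc matrix_mul_assoc[symmetric] unitary_simps[OF U])
         (metis matrix_vector_mul_assoc matrix_vector_mult_0_right)
    moreover have "invertible A" using assms by (simp add: PP_def)
    ultimately show False
      by (metis inj_matrix_vector_mult injD matrix_vector_mult_0_right)
  qed
  ultimately have "0 < d i" for i by (simp add: order_less_le)
  with U A that show thesis by blast
qed

lemma PP_pos_definite:
  assumes "A \<in> PP" "x \<noteq> 0"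
  shows "0 < x \<bullet> (A *v x)"
proof -
  obtain U d where U: "unitary_op U" and d: "\<And>i. 0 < d i" and A: "A = congd U d"
    using PP_spectral[OF assms(1)] by blast
  have "cadjoint U *v x \<noteq> 0"
    using assms(2) by (metis U matrix_vector_mul_assoc matrix_vector_mul_lid matrix_vector_mult_0_right unitary_op_def)
  then obtain i where "(cadjoint U *v x) $ i \<noteq> 0"
    by (auto simp: vec_eq_iff)
  then show ?thesis
    using d unfolding A congd_inner by (intro sum_pos2[of _ i]) (auto simp: less_imp_le)
qed

lemma PP_I:
  assumes "selfadjoint_op A" "\<And>x. x \<noteq> 0 \<Longrightarrow> 0 < x \<bullet> (A *v x)"
  shows "A \<in> PP"
proof -
  have "0 \<le> x \<bullet> (A *v x)" for x
    using assms(2)[of x] by (cases "x = 0") auto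
  moreover have "invertible A"
    unfolding invertible_left_inverse matrix_left_invertible_ker
    using assms(2) by force
  ultimately show ?thesis using assms by (simp add: PP_def positive_op_inner)
qed

lemma PP_selfadjoint: "A \<in> PP \<Longrightarrow> selfadjoint_op A"
  by (simp add: PP_def positive_op_def)

lemma PP_up: "A \<in> PP \<Longrightarrow> A \<preceq> B \<Longrightarrow> B \<in> PP"
  by (rule PP_I, metis PP_selfadjoint selfadjoint_op_le)
     (metis PP_pos_definite op_le_inner order_less_le_trans)

lemma PP_scaleR: "A \<in> PP \<Longrightarrow> 0 < c \<Longrightarrow> c *\<^sub>R A \<in> PP"
  by (rule PP_I, metis PP_selfadjoint cadjoint_scaleR selfadjoint_op_def)
     (simp add: scaleR_mat_vec PP_pos_definite)

lemma PP_mat_1: "mat 1 \<in> PP"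
  by (rule PP_I) (simp_all add: selfadjoint_op_def)

lemma PP_congruence:
  assumes "A \<in> PP" "invertible T"
  shows "T ** A ** cadjoint T \<in> PP"
proof -
  obtain U d where U: "unitary_op U" and d: "\<And>i. 0 < d i" and A: "A = congd U d"
    using PP_spectral[OF assms(1)] by blast
  then show ?thesis
    using congd_PP[OF invertible_mult[OF assms(2) invertible_unitary[OF U]] d] by (simp add: congd_mult_left)
qed

section \<open>Kubo-Ando means under simultaneous diagonalization\<close>

lemma op_powr_half:
  assumes "X \<in> PP"
  shows "cadjoint (op_powr X (1/2)) = op_powr X (1/2)" "cadjoint (op_powr X (-1/2)) = op_powr X (-1/2)"
    "op_powr X (1/2) ** op_powr X (-1/2) = mat 1" "op_powr X (-1/2) ** op_powr X (1/2) = mat 1"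
    "op_powr X (1/2) ** op_powr X (1/2) = X"
proof -
  obtain U d where U: "unitary_op U" and d: "\<And>i. 0 < d i" and X: "X = congd U d"
    using PP_spectral[OF assms(1)] by blast
  have p: "op_powr X p = congd U (\<lambda>i. d i powr p)" for p
    by (simp add: op_powr_def X fun_calc_congd[OF U])
  have m: "op_powr X p ** op_powr X q = congd U (\<lambda>i. d i powr (p + q))" for p q
  proof -
    have "real_diag a ** (real_diag b ** Y) = real_diag (\<lambda>i. a i * b i) ** Y" for a b and Y :: "'a oper"
      by (simp add: matrix_mul_assoc real_diag_mult)
    then show ?thesis
      by (simp add: p congd_def matrix_mul_assoc[symmetric] unitary_simps[OF U] powr_add)
  qed
  show "op_powr X (1/2) ** op_powr X (-1/2) = mat 1" "op_powr X (-1/2) ** op_powr X (1/2) = mat 1"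
    "op_powr X (1/2) ** op_powr X (1/2) = X"
    using d unfolding m by (simp_all add: X less_imp_neq[symmetric] abs_of_pos congd_one unitary_simps[OF U])
  show "cadjoint (op_powr X (1/2)) = op_powr X (1/2)" "cadjoint (op_powr X (-1/2)) = op_powr X (-1/2)"
    unfolding p using selfadjoint_congd by (auto simp: selfadjoint_op_def)
qed

text \<open>For X = \<open>congd T a\<close> the matrix V = X^(-1/2) T diag(sqrt a) is unitary, as V
  times its adjoint is X^(-1/2) X X^(-1/2). It diagonalizes the argument of \<open>fun_calc\<close>
  with eigenvalues \<open>b i / a i\<close>, after which the square roots of X cancel.\<close>

lemma ka_mean_congd:
  assumes T: "invertible T" and a: "\<And>i. 0 < a i"
  shows "ka_mean f (congd T a) (congd T b) = congd T (\<lambda>i. a i * f (b i / a i))"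
proof -
  define X P R where "X = congd T a" and "P = op_powr X (1/2)" and "R = op_powr X (-1/2)"
  have "X \<in> PP" using congd_PP[OF T a] by (simp add: X_def)
  note op = op_powr_half[OF this, folded P_def R_def]
  define V where "V = R ** T ** real_diag (\<lambda>i. sqrt (a i))"
  have V: "congd V c = R ** congd T (\<lambda>i. a i * c i) ** R" for c
  proof -
    have "(\<lambda>i. a i * c i) = (\<lambda>i. sqrt (a i) * (c i * sqrt (a i)))"
      using a by (simp add: fun_eq_iff less_imp_le mult_ac)
    then show ?thesis
      by (simp add: congd_def V_def cadjoint_mult op matrix_mul_assoc[symmetric] real_diag_mult[symmetric])
  qed
  have "V ** cadjoint V = R ** X ** R"
    using V[of "\<lambda>i. 1"] by (simp add: congd_one X_def)
  also have "\<dots> = R ** (P ** P) ** R"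
    by (simp only: op(5))
  also have "\<dots> = mat 1"
    by (simp only: matrix_mul_assoc[symmetric] op(3)) (simp add: op)
  finally have "unitary_op V"
    by (simp add: matrix_left_right_inverse unitary_opI)
  moreover have "R ** congd T b ** R = congd V (\<lambda>i. b i / a i)"
    using a by (simp add: V less_imp_neq[symmetric])
  ultimately have "ka_mean f X (congd T b) = P ** congd V (\<lambda>i. f (b i / a i)) ** P"
    by (simp only: ka_mean_def P_def[symmetric] R_def[symmetric] fun_calc_congd)
  also have "\<dots> = congd T (\<lambda>i. a i * f (b i / a i))"
    unfolding V by (simp add: matrix_mul_assoc[symmetric] op mult_cancel_left)
  finally show ?thesis by (simp add: X_def)
qed

text \<open>\<open>T\<close> is X^(1/2) times a unitary diagonalizing X^(-1/2) A X^(-1/2). With the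
  coefficients of \<open>X\<close> normalized to 1, \<open>ka_mean f X A\<close> just applies
  \<open>f\<close> to the coefficients of \<open>A\<close>.\<close>

lemma simultaneous_diagonalization:
  assumes X: "X \<in> PP" and A: "A \<in> PP"
  obtains T d where "invertible T" "\<And>i. 0 < d i" "X = congd T (\<lambda>i. 1)" "A = congd T d"
proof -
  define P R where "P = op_powr X (1/2)" and "R = op_powr X (-1/2)"
  note op = op_powr_half[OF X, folded P_def R_def]
  have "invertible R" "invertible P" unfolding invertible_def using op by blast+
  then have "R ** A ** R \<in> PP"
    using PP_congruence[OF A \<open>invertible R\<close>] by (simp add: op)
  then obtain V d where V: "unitary_op V" and d: "\<And>i. 0 < d i" and RAR: "R ** A ** R = congd V d"
    using PP_spectral by blast
  have "A = P ** (R ** A ** R) ** P"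
    by (simp add: matrix_mul_assoc[symmetric] op mult_cancel_left)
  then have "A = congd (P ** V) d"
    by (simp add: RAR congd_mult_left op)
  moreover have "X = congd (P ** V) (\<lambda>i. 1)"
    by (simp add: congd_one cadjoint_mult matrix_mul_assoc[symmetric] unitary_simps[OF V] op)
  ultimately show thesis
    using that[of "P ** V" d] d invertible_mult[OF \<open>invertible P\<close> invertible_unitary[OF V]] by blast
qed

text \<open>Here \<open>\<alpha>\<close> is the largest eigenvalue of the pencil: the order relation \<open>X \<preceq> \<alpha> *\<^sub>R Y\<close> is attained
  at \<open>v\<close>.  Evaluating at such a touching vector replaces all contraction estimates in the Thompson
  metric.\<close>

lemma touching_vector_exists:
  assumes "X \<in> PP" "Y \<in> PP"
  obtains \<alpha> v where "0 < \<alpha>" "v \<noteq> 0" "X \<preceq> \<alpha> *\<^sub>R Y" "X *v v = \<alpha> *\<^sub>R (Y *v v)"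
proof -
  obtain T d where T: "invertible T" and d: "\<And>i. 0 < d i" and Y: "Y = congd T (\<lambda>i. 1)" and X: "X = congd T d"
    using simultaneous_diagonalization[OF assms(2,1)] by blast
  have "Max (range d) \<in> range d" by (rule Max_in) auto
  then obtain k where "Max (range d) = d k" by blast
  then have k: "d i \<le> d k" for i
    by (metis Max_ge finite finite_imageI rangeI)
  have "X \<preceq> d k *\<^sub>R Y"
    using k by (simp add: X Y congd_scaleR congd_le_iff[OF T])
  moreover have "real_diag d *v axis k 1 = d k *\<^sub>R axis k 1"
    by (auto simp: vec_eq_iff real_diag_vec axis_def scaleR_conv_of_real[symmetric])
  then have "X *v (dual T *v axis k 1) = d k *\<^sub>R (Y *v (dual T *v axis k 1))"
    by (simp add: X Y congd_one congd_def matrix_vector_mul_assoc[symmetric] dual_axis[OF T]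
        mat_vec_scaleR)
  ultimately show thesis using that d dual_axis_nonzero[OF T] by blast
qed

section \<open>Monotonicity of geometric and power means\<close>

lemma ka_mean_congd_one:
  "invertible T \<Longrightarrow> ka_mean f (congd T (\<lambda>i. 1)) (congd T b) = congd T (\<lambda>i. f (b i))"
  by (simp add: ka_mean_congd)

lemma ka_mean_PP:
  assumes "X \<in> PP" "A \<in> PP" "\<And>t. 0 < t \<Longrightarrow> 0 < f t"
  shows "ka_mean f X A \<in> PP"
proof -
  obtain T d where "invertible T" "\<And>i. 0 < d i" "X = congd T (\<lambda>i. 1)" "A = congd T d"
    using simultaneous_diagonalization[OF assms(1,2)] by blast
  then show ?thesis using assms(3) by (simp add: ka_mean_congd_one congd_PP)
qed

lemma matrix_inv_PP:
  assumes "X \<in> PP"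
  shows "matrix_inv X \<in> PP" "matrix_inv (matrix_inv X) = X"
proof -
  obtain U d where U: "unitary_op U" and d: "\<And>i. 0 < d i" and X: "X = congd U d"
    using PP_spectral[OF assms] by blast
  then show "matrix_inv X \<in> PP"
    by (simp add: matrix_inv_congd invertible_unitary less_imp_neq[symmetric] congd_PP invertible_dual)
  have "matrix_inv X ** X = mat 1"
    using assms by (simp add: PP_def matrix_inv_mult)
  then show "matrix_inv (matrix_inv X) = X"
    by (rule matrix_inv_eqI)
qed

lemma matrix_inv_antimono:
  assumes "X \<in> PP" "X \<preceq> Y"
  shows "matrix_inv Y \<preceq> matrix_inv X"
proof -
  obtain T d where T: "invertible T" and d: "\<And>i. 0 < d i" and X: "X = congd T (\<lambda>i. 1)" and Y: "Y = congd T d"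
    using simultaneous_diagonalization[OF assms(1) PP_up[OF assms]] by blast
  have "1 \<le> d i" for i
    using assms(2) congd_le_iff[OF T, of "\<lambda>i. 1" d] by (simp add: X Y)
  then have "1 / d i \<le> 1" for i
    using d[of i] by simp
  then show ?thesis
    by (simp add: X Y matrix_inv_congd[OF T] less_imp_neq[OF d, symmetric]
        congd_le_iff[OF invertible_dual[OF T]])
qed

lemma scaleR_le_scaleR: "Y \<in> PP \<Longrightarrow> a \<le> b \<Longrightarrow> a *\<^sub>R Y \<preceq> b *\<^sub>R Y"
  using positive_op_scaleR[of Y "b - a"] by (simp add: op_le_def PP_def scaleR_diff_left)

text \<open>The forms of \<open>X\<close> and \<open>a *\<^sub>R Y\<close> agree at
  \<open>v\<close>. Touching arguments end here: they produce a bound with a factor smaller than the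
  touching one.\<close>

lemma touching_factor_le:
  assumes "X *v v = a *\<^sub>R (Y *v v)" "v \<noteq> 0" "Y \<in> PP" "X \<preceq> b *\<^sub>R Y"
  shows "a \<le> b"
proof -
  have "a * (v \<bullet> (Y *v v)) \<le> b * (v \<bullet> (Y *v v))"
    using op_le_inner[OF assms(4), of v] by (simp add: assms(1) scaleR_mat_vec)
  then show ?thesis using PP_pos_definite[OF assms(3,2)] by simp
qed

text \<open>The extremal factor is either at most 1, which gives the claim, or above 1, and then the
  bound and the touching vector are both available for a contradiction.\<close>

lemma op_le_by_touching:
  assumes X: "X \<in> PP" and Y: "Y \<in> PP"
    and *: "\<And>\<alpha> v. 1 < \<alpha> \<Longrightarrow> v \<noteq> 0 \<Longrightarrow> X \<preceq> \<alpha> *\<^sub>R Y \<Longrightarrow> X *v v = \<alpha> *\<^sub>R (Y *v v) \<Longrightarrow> False"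
  shows "X \<preceq> Y"
proof -
  obtain \<alpha> v where \<alpha>: "v \<noteq> 0" "X \<preceq> \<alpha> *\<^sub>R Y" "X *v v = \<alpha> *\<^sub>R (Y *v v)"
    using touching_vector_exists[OF X Y] by blast
  then have "\<alpha> \<le> 1" using * by force
  then show ?thesis
    using op_le_trans[OF \<alpha>(2) scaleR_le_scaleR[OF Y]] by force
qed

definition mean_monotone :: "('d::finite oper \<Rightarrow> 'd oper \<Rightarrow> 'd oper) \<Rightarrow> bool" where
  "mean_monotone \<sigma> \<longleftrightarrow> (\<forall>X X' A A'. X \<in> PP \<longrightarrow> X' \<in> PP \<longrightarrow> A \<in> PP \<longrightarrow> A' \<in> PP \<longrightarrow>
      X \<preceq> X' \<longrightarrow> A \<preceq> A' \<longrightarrow> \<sigma> X A \<preceq> \<sigma> X' A')"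

lemma mean_monotoneD:
  "mean_monotone \<sigma> \<Longrightarrow> X \<in> PP \<Longrightarrow> X' \<in> PP \<Longrightarrow> A \<in> PP \<Longrightarrow> A' \<in> PP \<Longrightarrow>
    X \<preceq> X' \<Longrightarrow> A \<preceq> A' \<Longrightarrow> \<sigma> X A \<preceq> \<sigma> X' A'"
  by (simp add: mean_monotone_def)

lemma geo_mean_congd_one:
  "invertible T \<Longrightarrow> geo_mean r (congd T (\<lambda>i. 1)) (congd T b) = congd T (\<lambda>i. b i powr r)"
  by (simp add: geo_mean_def ka_mean_congd_one)

lemma geo_mean_PP: "X \<in> PP \<Longrightarrow> A \<in> PP \<Longrightarrow> geo_mean r X A \<in> PP"
  by (simp add: geo_mean_def ka_mean_PP)

text \<open>The Riccati equation G X^(-1) G = A, tested at \<open>v\<close>. In this form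
  \<open>G\<close> enters only through its value at \<open>v\<close>, which is what a touching
  vector controls.\<close>

lemma geo_mean_half_riccati:
  assumes "X \<in> PP" "A \<in> PP"
  defines "G \<equiv> geo_mean (1/2) X A"
  shows "(G *v v) \<bullet> (matrix_inv X *v (G *v v)) = v \<bullet> (A *v v)"
proof -
  obtain T d where T: "invertible T" and d: "\<And>i. 0 < d i" and X: "X = congd T (\<lambda>i. 1)" and A: "A = congd T d"
    using simultaneous_diagonalization[OF assms(1,2)] by blast
  have G: "G = congd T (\<lambda>i. d i powr (1/2))"
    by (simp add: G_def X A geo_mean_congd_one[OF T])
  have d2: "d i powr (1/2) * d i powr (1/2) = d i" for i
    using d[of i] by (simp flip: powr_add)
  have "real_diag (\<lambda>i. d i powr (1/2)) ** (real_diag (\<lambda>i. d i powr (1/2)) ** Y) = real_diag d ** Y" for Y :: "'a oper"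
    by (simp only: matrix_mul_assoc real_diag_mult d2)
  then have "G ** matrix_inv X ** G = A"
    by (simp add: G X A matrix_inv_congd[OF T])
       (simp add: congd_def real_diag_one matrix_mul_assoc[symmetric] dual_simps[OF T])
  moreover have "(G *v v) \<bullet> (matrix_inv X *v (G *v v)) = v \<bullet> ((G ** matrix_inv X ** G) *v v)"
    using selfadjoint_inner[of G v] selfadjoint_congd[of T]
    by (simp add: G matrix_vector_mul_assoc matrix_mul_assoc)
  ultimately show ?thesis by simp
qed

text \<open>Put \<open>u = G' *v v\<close>, so that \<open>G *v v\<close> is \<alpha> times
  \<open>u\<close>. The Riccati equations and antitonicity of inversion bound \<alpha>^2 times the
  form of X^(-1) at \<open>u\<close> by that form itself, so \<alpha> cannot exceed 1.\<close>

lemma geo_mean_half_monotone: "mean_monotone (geo_mean (1/2))"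
  unfolding mean_monotone_def
proof (intro allI impI)
  fix X X' A A' :: "'a oper"
  assume PP: "X \<in> PP" "X' \<in> PP" "A \<in> PP" "A' \<in> PP" and le: "X \<preceq> X'" "A \<preceq> A'"
  define G G' where "G = geo_mean (1/2) X A" and "G' = geo_mean (1/2) X' A'"
  show "geo_mean (1/2) X A \<preceq> geo_mean (1/2) X' A'"
    unfolding G_def[symmetric] G'_def[symmetric]
  proof (rule op_le_by_touching)
    show "G \<in> PP" "G' \<in> PP" using PP by (simp_all add: G_def G'_def geo_mean_PP)
    fix \<alpha> v assume \<alpha>: "1 < \<alpha>" "v \<noteq> 0" "G *v v = \<alpha> *\<^sub>R (G' *v v)"
    define u where "u = G' *v v"
    have "\<alpha> * \<alpha> * (u \<bullet> (matrix_inv X *v u)) = v \<bullet> (A *v v)"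
      using geo_mean_half_riccati[OF PP(1,3), of v] \<alpha>(3)
      by (simp add: G_def[symmetric] u_def mat_vec_scaleR mult.assoc)
    also have "\<dots> \<le> v \<bullet> (A' *v v)"
      by (rule op_le_inner[OF le(2)])
    also have "\<dots> = u \<bullet> (matrix_inv X' *v u)"
      using geo_mean_half_riccati[OF PP(2,4), of v] by (simp add: G'_def[symmetric] u_def)
    also have "\<dots> \<le> u \<bullet> (matrix_inv X *v u)"
      by (rule op_le_inner[OF matrix_inv_antimono[OF PP(1) le(1)]])
    finally have "\<alpha> * \<alpha> * (u \<bullet> (matrix_inv X *v u)) \<le> 1 * (u \<bullet> (matrix_inv X *v u))" by simp
    moreover have "u \<noteq> 0"
      using PP_pos_definite[OF \<open>G' \<in> PP\<close> \<alpha>(2)] by (auto simp: u_def)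
    then have "0 < u \<bullet> (matrix_inv X *v u)"
      by (intro PP_pos_definite matrix_inv_PP PP)
    ultimately have "\<alpha> * \<alpha> \<le> 1"
      by (simp only: mult_le_cancel_right_pos)
    then show False using less_1_mult[OF \<alpha>(1) \<alpha>(1)] by simp
  qed
qed

text \<open>On the path from \<open>X\<close> to \<open>A\<close> midpoints are geometric means; so
  monotonicity at two exponents passes to their midpoint.\<close>

lemma geo_mean_midpoint:
  assumes "X \<in> PP" "A \<in> PP"
  shows "geo_mean ((p + q) / 2) X A = geo_mean (1/2) (geo_mean p X A) (geo_mean q X A)"
proof -
  obtain T d where T: "invertible T" and d: "\<And>i. 0 < d i" and X: "X = congd T (\<lambda>i. 1)" and A: "A = congd T d"
    using simultaneous_diagonalization[OF assms(1,2)] by blast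
  have "d i powr p * (d i powr q / d i powr p) powr (1/2) = d i powr ((p + q) / 2)" for i
    using d[of i]
    by (simp add: powr_diff[symmetric] powr_powr powr_add[symmetric] add_divide_distrib diff_divide_distrib)
  moreover have "0 < d i powr p" for i
    using d[of i] by simp
  ultimately show ?thesis
    by (simp add: X A geo_mean_congd_one[OF T])
      (simp add: geo_mean_def ka_mean_congd[OF T])
qed

text \<open>If \<open>x\<close> were missing, the nearest points of \<open>S\<close> on its two
  sides would have a midpoint in \<open>S\<close> strictly between them.\<close>

lemma closed_midpoint_interval:
  fixes S :: "real set"
  assumes "closed S" "0 \<in> S" "1 \<in> S" and mid: "\<And>p q. p \<in> S \<Longrightarrow> q \<in> S \<Longrightarrow> (p + q) / 2 \<in> S"
    and x: "x \<in> {0..1}"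
  shows "x \<in> S"
proof (rule ccontr)
  assume "x \<notin> S"
  define a b where "a = Sup (S \<inter> {..x})" and "b = Inf (S \<inter> {x..})"
  have a: "a \<in> S \<inter> {..x}"
    unfolding a_def using assms x by (intro closed_contains_Sup closed_Int) (auto intro: exI[of _ 0] bdd_aboveI)
  have b: "b \<in> S \<inter> {x..}"
    unfolding b_def using assms x by (intro closed_contains_Inf closed_Int) (auto intro: exI[of _ 1] bdd_belowI)
  have ab: "a < x" "x < b" using a b \<open>x \<notin> S\<close> by (auto simp: order_less_le)
  let ?m = "(a + b) / 2"
  have m: "?m \<in> S" using mid a b by blast
  show False
  proof (cases "?m \<le> x")
    case True
    then have "?m \<le> Sup (S \<inter> {..x})"
      using m by (intro cSup_upper bdd_aboveI[of _ x]) auto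
    then show False using ab by (simp flip: a_def)
  next
    case False
    then have "Inf (S \<inter> {x..}) \<le> ?m"
      using m by (intro cInf_lower bdd_belowI[of _ x]) auto
    then show False using ab by (simp flip: b_def)
  qed
qed

lemma tendsto_congd [tendsto_intros]:
  assumes "\<And>i. ((\<lambda>k. d k i) \<longlongrightarrow> e i) F"
  shows "((\<lambda>k. congd T (d k)) \<longlongrightarrow> congd T e) F"
  unfolding congd_def using assms by (intro tendsto_intros)

text \<open>A two-variable Loewner-Heinz inequality: the admissible exponents form a closed set that
  contains 0 and 1 and is stable under midpoints.\<close>

theorem geo_mean_monotone:
  assumes "0 \<le> r" "r \<le> 1"
  shows "mean_monotone (geo_mean r :: 'd::finite oper \<Rightarrow> _)"
proof -
  define S where "S = {r. mean_monotone (geo_mean r :: 'd oper \<Rightarrow> _)}"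
  have lim: "(\<lambda>k. geo_mean (c k) X A) \<longlonglongrightarrow> geo_mean l X A" if c: "c \<longlonglongrightarrow> l" and PP: "X \<in> PP" "A \<in> PP"
    for c l and X A :: "'d oper"
  proof -
    obtain T d where T: "invertible T" and d: "\<And>i. 0 < d i" and X: "X = congd T (\<lambda>i. 1)" and A: "A = congd T d"
      using simultaneous_diagonalization[OF PP] by blast
    have "(\<lambda>k. congd T (\<lambda>i. d i powr c k)) \<longlonglongrightarrow> congd T (\<lambda>i. d i powr l)"
      using c d by (intro tendsto_intros) (auto simp: less_imp_neq[symmetric])
    then show ?thesis by (simp add: X A geo_mean_congd_one[OF T])
  qed
  have "closed S"
    unfolding closed_sequential_limits
  proof (intro allI impI, elim conjE)
    fix c :: "nat \<Rightarrow> real" and l assume c: "\<forall>n. c n \<in> S" "c \<longlonglongrightarrow> l"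
    show "l \<in> S"
      unfolding S_def mean_monotone_def mem_Collect_eq
    proof (intro allI impI)
      fix X X' A A' :: "'d oper"
      assume PP: "X \<in> PP" "X' \<in> PP" "A \<in> PP" "A' \<in> PP" "X \<preceq> X'" "A \<preceq> A'"
      have "\<forall>k. geo_mean (c k) X A \<preceq> geo_mean (c k) X' A'"
        using c(1) PP unfolding S_def mean_monotone_def by blast
      then show "geo_mean l X A \<preceq> geo_mean l X' A'"
        by (intro op_le_tendsto[OF lim[OF c(2)] lim[OF c(2)]]) (auto simp: PP)
    qed
  qed
  moreover have "geo_mean 0 X A = X" "geo_mean 1 X A = A" if XA: "X \<in> PP" "A \<in> PP" for X A :: "'d oper"
  proof -
    obtain T d where T: "invertible T" and d: "\<And>i. 0 < d i" and X: "X = congd T (\<lambda>i. 1)" and A: "A = congd T d"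
      using simultaneous_diagonalization[OF XA] by blast
    show "geo_mean 0 X A = X" "geo_mean 1 X A = A"
      using d by (simp_all add: X A geo_mean_congd_one[OF T] less_imp_neq[symmetric] abs_of_pos)
  qed
  then have "0 \<in> S" "1 \<in> S" by (simp_all add: S_def mean_monotone_def)
  moreover have "(p + q) / 2 \<in> S" if pq: "p \<in> S" "q \<in> S" for p q
    unfolding S_def mean_monotone_def mem_Collect_eq
  proof (intro allI impI)
    fix X X' A A' :: "'d oper"
    assume PP: "X \<in> PP" "X' \<in> PP" "A \<in> PP" "A' \<in> PP" "X \<preceq> X'" "A \<preceq> A'"
    have "geo_mean p X A \<preceq> geo_mean p X' A'" "geo_mean q X A \<preceq> geo_mean q X' A'"
      using pq PP unfolding S_def mean_monotone_def by blast+
    then show "geo_mean ((p + q) / 2) X A \<preceq> geo_mean ((p + q) / 2) X' A'"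
      unfolding geo_mean_midpoint[OF PP(1,3)] geo_mean_midpoint[OF PP(2,4)]
      by (intro mean_monotoneD[OF geo_mean_half_monotone]) (simp_all add: PP geo_mean_PP)
  qed
  moreover have "r \<in> {0..1}" using assms by simp
  ultimately have "r \<in> S"
    by (rule closed_midpoint_interval)
  then show ?thesis by (simp add: S_def)
qed

section \<open>Power means of two operators\<close>

definition power_fun :: "real \<Rightarrow> real \<Rightarrow> real \<Rightarrow> real" where
  "power_fun s r t = (if r = 0 then t powr s else (1 - s + s * t powr r) powr (1 / r))"

lemma bin_power_mean_eq: "bin_power_mean s r = ka_mean (power_fun s r)"
  by (auto simp: bin_power_mean_def geo_mean_def power_fun_def[abs_def])

lemma power_fun_base_pos: "0 \<le> s \<Longrightarrow> s \<le> 1 \<Longrightarrow> 0 < t \<Longrightarrow> 0 < 1 - s + s * t powr r" for s :: real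
  by (cases "s = 1") (auto intro: add_pos_nonneg)

lemma power_fun_pos: "0 \<le> s \<Longrightarrow> s \<le> 1 \<Longrightarrow> 0 < t \<Longrightarrow> 0 < power_fun s r t"
  using power_fun_base_pos[of s t r] by (simp add: power_fun_def)

lemma power_fun_powr:
  assumes "0 \<le> s" "s \<le> 1" "0 < t" "r \<noteq> 0"
  shows "power_fun s r t powr r = 1 - s + s * t powr r"
  using power_fun_base_pos[OF assms(1-3), of r] assms(4) by (simp add: power_fun_def powr_powr)

text \<open>The adjoint of the mean p_{s,r} is p_{s,-r}; this is the bridge to negative
  exponents.\<close>

lemma power_fun_inverse:
  assumes "0 \<le> s" "s \<le> 1" "0 < t"
  shows "power_fun s (- r) (1 / t) = 1 / power_fun s r t"
  using assms(3) by (simp add: power_fun_def powr_divide powr_minus_divide)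

text \<open>For r > 0 the exponent \<open>1 - r\<close> is below 1, and this gain drives the
  contraction for power means.\<close>

lemma geo_mean_scaleR_left:
  assumes "Y \<in> PP" "X \<in> PP" "0 < \<alpha>"
  shows "geo_mean r (\<alpha> *\<^sub>R Y) X = \<alpha> powr (1 - r) *\<^sub>R geo_mean r Y X"
proof -
  obtain T d where T: "invertible T" and d: "\<And>i. 0 < d i" and Y: "Y = congd T (\<lambda>i. 1)" and X: "X = congd T d"
    using simultaneous_diagonalization[OF assms(1,2)] by blast
  have "\<alpha> * (d i / \<alpha>) powr r = \<alpha> powr (1 - r) * d i powr r" for i
    using d[of i] assms(3) by (simp add: powr_divide powr_diff)
  then show ?thesis
    using assms(3) by (simp add: X Y geo_mean_def congd_scaleR ka_mean_congd[OF T])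
qed

text \<open>The power mean \<open>Y\<close> of \<open>X\<close> and \<open>A\<close> solves \<open>Y = (1 - s) (Y #\<^sub>r X) + s (Y #\<^sub>r A)\<close>, an equation
  whose right-hand side is monotone; this replaces the analytic proof of operator monotonicity.\<close>

lemma power_mean_fixed_point:
  assumes PP: "X \<in> PP" "A \<in> PP" and s: "0 \<le> s" "s \<le> 1" and r: "r \<noteq> 0"
  defines "Y \<equiv> ka_mean (power_fun s r) X A"
  shows "Y = (1 - s) *\<^sub>R geo_mean r Y X + s *\<^sub>R geo_mean r Y A"
proof -
  obtain T d where T: "invertible T" and d: "\<And>i. 0 < d i" and X: "X = congd T (\<lambda>i. 1)" and A: "A = congd T d"
    using simultaneous_diagonalization[OF PP] by blast
  define y where "y i = power_fun s r (d i)" for i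
  have y: "0 < y i" for i using s d by (simp add: y_def power_fun_pos)
  have Y: "Y = congd T y"
    by (simp add: Y_def X A ka_mean_congd_one[OF T] y_def[abs_def])
  have "(1 - s) * (y i * (1 / y i) powr r) + s * (y i * (d i / y i) powr r) = y i" for i
  proof -
    have "(1 - s) * (y i * (1 / y i) powr r) + s * (y i * (d i / y i) powr r)
        = y i * ((1 - s + s * d i powr r) / y i powr r)"
      using y[of i] d[of i] by (simp add: powr_divide add_divide_distrib diff_divide_distrib algebra_simps)
    also have "\<dots> = y i"
      using power_fun_powr[OF s d r, of i] power_fun_base_pos[OF s d, of i r] by (simp flip: y_def)
    finally show ?thesis .
  qed
  then show ?thesis
    by (simp add: Y) (simp add: X A geo_mean_def ka_mean_congd[OF T y] congd_scaleR congd_add)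
qed

text \<open>A bound of \<open>Y\<close> by \<alpha> times \<open>Y'\<close> is improved to the
  factor \<alpha>^(1-r) by the fixed point equations and monotonicity of #_r in both arguments; for
  \<alpha> > 1 this contradicts touching.\<close>

lemma power_fun_mean_monotone_pos:
  assumes s: "0 \<le> s" "s \<le> 1" and r: "0 < r" "r \<le> 1"
  shows "mean_monotone (ka_mean (power_fun s r) :: 'd::finite oper \<Rightarrow> _)"
  unfolding mean_monotone_def
proof (intro allI impI)
  fix X X' A A' :: "'d oper"
  assume PP: "X \<in> PP" "X' \<in> PP" "A \<in> PP" "A' \<in> PP" and le: "X \<preceq> X'" "A \<preceq> A'"
  define Y Y' where "Y = ka_mean (power_fun s r) X A" and "Y' = ka_mean (power_fun s r) X' A'"
  show "ka_mean (power_fun s r) X A \<preceq> ka_mean (power_fun s r) X' A'"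
    unfolding Y_def[symmetric] Y'_def[symmetric]
  proof (rule op_le_by_touching)
    show Y: "Y \<in> PP" "Y' \<in> PP" using PP s by (simp_all add: Y_def Y'_def ka_mean_PP power_fun_pos)
    fix \<alpha> v assume \<alpha>: "1 < \<alpha>" "v \<noteq> 0" "Y \<preceq> \<alpha> *\<^sub>R Y'" "Y *v v = \<alpha> *\<^sub>R (Y' *v v)"
    then have aY: "\<alpha> *\<^sub>R Y' \<in> PP" using Y by (intro PP_scaleR) auto
    have "geo_mean r Y X \<preceq> geo_mean r (\<alpha> *\<^sub>R Y') X'" "geo_mean r Y A \<preceq> geo_mean r (\<alpha> *\<^sub>R Y') A'"
      using geo_mean_monotone[of r, where 'd = 'd] r PP le \<alpha>(3) Y aY unfolding mean_monotone_def by auto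
    then have "(1 - s) *\<^sub>R geo_mean r Y X + s *\<^sub>R geo_mean r Y A
      \<preceq> (1 - s) *\<^sub>R geo_mean r (\<alpha> *\<^sub>R Y') X' + s *\<^sub>R geo_mean r (\<alpha> *\<^sub>R Y') A'"
      using s by (intro op_le_add op_le_scaleR) auto
    also have "(1 - s) *\<^sub>R geo_mean r (\<alpha> *\<^sub>R Y') X' + s *\<^sub>R geo_mean r (\<alpha> *\<^sub>R Y') A'
      = \<alpha> powr (1 - r) *\<^sub>R ((1 - s) *\<^sub>R geo_mean r Y' X' + s *\<^sub>R geo_mean r Y' A')"
      using \<alpha>(1) Y PP by (simp add: geo_mean_scaleR_left scaleR_add_right mult.commute)
    finally have "Y \<preceq> \<alpha> powr (1 - r) *\<^sub>R Y'"
      using power_mean_fixed_point[OF PP(1,3) s, of r] power_mean_fixed_point[OF PP(2,4) s, of r] r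
      by (simp add: Y_def[symmetric] Y'_def[symmetric])
    then have "\<alpha> \<le> \<alpha> powr (1 - r)"
      by (rule touching_factor_le[OF \<alpha>(4,2) Y(2)])
    moreover have "\<alpha> powr (1 - r) < \<alpha> powr 1"
      using \<alpha>(1) r by (intro powr_less_mono) auto
    ultimately show False using \<alpha>(1) by simp
  qed
qed

lemma matrix_inv_ka_mean:
  assumes "X \<in> PP" "A \<in> PP" "\<And>t. 0 < t \<Longrightarrow> 0 < f t" "\<And>t. 0 < t \<Longrightarrow> g (1 / t) = 1 / f t"
  shows "matrix_inv (ka_mean f X A) = ka_mean g (matrix_inv X) (matrix_inv A)"
proof -
  obtain T d where T: "invertible T" and d: "\<And>i. 0 < d i" and X: "X = congd T (\<lambda>i. 1)" and A: "A = congd T d"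
    using simultaneous_diagonalization[OF assms(1,2)] by blast
  have "f (d i) \<noteq> 0" for i using assms(3)[OF d[of i]] by simp
  then show ?thesis
    using assms(4) d by (simp add: X A ka_mean_congd_one[OF T] matrix_inv_congd[OF T] less_imp_neq[symmetric]
        ka_mean_congd_one[OF invertible_dual[OF T]])
qed

theorem power_fun_mean_monotone:
  assumes s: "0 \<le> s" "s \<le> 1" and r: "- 1 \<le> r" "r \<le> 1"
  shows "mean_monotone (ka_mean (power_fun s r) :: 'd::finite oper \<Rightarrow> _)"
proof -
  consider "0 < r" | "r = 0" | "r < 0" by linarith
  then show ?thesis
  proof cases
    case 1 then show ?thesis using power_fun_mean_monotone_pos s r by blast
  next
    case 2
    then have "(ka_mean (power_fun s r) :: 'd oper \<Rightarrow> _) = geo_mean s"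
      by (simp add: geo_mean_def power_fun_def[abs_def])
    then show ?thesis using geo_mean_monotone[OF s] by simp
  next
    case 3
    show ?thesis
      unfolding mean_monotone_def
    proof (intro allI impI)
      fix X X' A A' :: "'d oper"
      assume PP: "X \<in> PP" "X' \<in> PP" "A \<in> PP" "A' \<in> PP" and le: "X \<preceq> X'" "A \<preceq> A'"
      \<comment> \<open>Conjugation by inversion replaces \<open>r\<close> by \<open>- r\<close> and
        reverses the order twice.\<close>
      have inv: "ka_mean (power_fun s r) X A =
          matrix_inv (ka_mean (power_fun s (- r)) (matrix_inv X) (matrix_inv A))"
        if "X \<in> PP" "A \<in> PP" for X A :: "'d oper"
        using that s power_fun_inverse[OF s, of _ "- r"]
        by (subst matrix_inv_ka_mean[where g = "power_fun s r"])
           (auto simp: power_fun_pos matrix_inv_PP)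
      have "mean_monotone (ka_mean (power_fun s (- r)) :: 'd oper \<Rightarrow> _)"
        using 3 r s by (intro power_fun_mean_monotone_pos) auto
      then have "ka_mean (power_fun s (- r)) (matrix_inv X') (matrix_inv A')
          \<preceq> ka_mean (power_fun s (- r)) (matrix_inv X) (matrix_inv A)"
        unfolding mean_monotone_def
        using PP le by (simp add: matrix_inv_PP matrix_inv_antimono)
      then show "ka_mean (power_fun s r) X A \<preceq> ka_mean (power_fun s r) X' A'"
        unfolding inv[OF PP(1,3)] inv[OF PP(2,4)]
        by (rule matrix_inv_antimono[rotated]) (use PP s in \<open>auto intro!: ka_mean_PP matrix_inv_PP power_fun_pos\<close>)
    qed
  qed
qed

text \<open>Strictness, which requires s > 0, feeds the uniqueness proof for the fixed point
  equation. For r < 0 two decreasing maps are composed.\<close>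

lemma power_fun_strict_mono:
  assumes "0 < s" "s \<le> 1" "0 < t" "t < u"
  shows "power_fun s r t < power_fun s r u"
proof -
  have pos: "0 < 1 - s + s * t powr r" "0 < 1 - s + s * u powr r"
    using assms power_fun_base_pos[of s] by auto
  consider "0 < r" | "r = 0" | "r < 0" by linarith
  then show ?thesis
  proof cases
    case 1
    then have "1 - s + s * t powr r < 1 - s + s * u powr r"
      using assms by (simp add: powr_less_mono2)
    then show ?thesis using 1 pos by (simp add: power_fun_def powr_less_mono2)
  next
    case 2 then show ?thesis using assms by (simp add: power_fun_def powr_less_mono2)
  next
    case 3
    then have "1 - s + s * u powr r < 1 - s + s * t powr r"
      using assms by (simp add: powr_less_mono2_neg)
    then show ?thesis using 3 pos by (simp add: power_fun_def powr_less_mono2_neg)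
  qed
qed

section \<open>Continuity of the functional calculus\<close>

text \<open>The removable singularity at 0 is filled by the derivative. Quotients by
  \<open>r\<close> and \<open>s\<close> written through such functions are jointly continuous up to
  r = 0 and s = 0.\<close>

lemma continuous_on_difference_quotient:
  fixes f :: "real \<Rightarrow> real"
  assumes S: "open S" and f: "continuous_on S f" and f0: "f 0 = 0" and f': "DERIV f 0 :> 1"
  shows "continuous_on S (\<lambda>x. if x = 0 then 1 else f x / x)"
  unfolding continuous_on_eq_continuous_at[OF S]
proof
  fix x assume x: "x \<in> S"
  show "isCont (\<lambda>x. if x = 0 then 1 else f x / x) x"
  proof (cases "x = 0")
    case True
    have "((\<lambda>x. f x / x) \<longlongrightarrow> 1) (at 0)"
      using f' f0 by (simp add: DERIV_def)
    then have "((\<lambda>x. if x = 0 then 1 else f x / x) \<longlongrightarrow> 1) (at 0)"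
      by (rule Lim_transform_eventually) (auto simp: eventually_at_filter)
    then show ?thesis by (simp add: True isCont_def)
  next
    case False
    have "isCont (\<lambda>x. f x / x) x"
      using f S x False by (auto intro!: continuous_intros simp: continuous_on_eq_continuous_at)
    moreover have "eventually (\<lambda>y. (if y = 0 then 1 else f y / y) = f y / y) (nhds x)"
      using t1_space_nhds[OF False] by eventually_elim simp
    ultimately show ?thesis by (simp add: isCont_cong)
  qed
qed

definition exp_quot :: "real \<Rightarrow> real" where
  "exp_quot x = (if x = 0 then 1 else (exp x - 1) / x)"

definition ln_quot :: "real \<Rightarrow> real" where
  "ln_quot x = (if x = 0 then 1 else ln (1 + x) / x)"

lemma continuous_on_exp_quot: "continuous_on UNIV exp_quot"
  unfolding exp_quot_def[abs_def]
  by (rule continuous_on_difference_quotient) (auto intro!: continuous_intros derivative_eq_intros)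

lemma continuous_on_ln_quot: "continuous_on {-1<..} ln_quot"
  unfolding ln_quot_def[abs_def]
  by (rule continuous_on_difference_quotient) (auto intro!: continuous_intros derivative_eq_intros)

lemma mult_exp_quot: "x * exp_quot x = exp x - 1"
  by (simp add: exp_quot_def)

lemma mult_ln_quot: "x * ln_quot x = ln (1 + x)"
  by (simp add: ln_quot_def)

text \<open>\<open>power_log r t\<close> is \<open>(t powr r - 1) / r\<close>, extended continuously by \<open>ln t\<close> to \<open>r = 0\<close>.\<close>

definition power_log :: "real \<Rightarrow> real \<Rightarrow> real" where
  "power_log r t = ln t * exp_quot (r * ln t)"

lemma power_log_zero: "power_log 0 t = ln t"
  by (simp add: power_log_def exp_quot_def)

lemma mult_power_log: "0 < t \<Longrightarrow> r * power_log r t = t powr r - 1"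
  using mult_exp_quot[of "r * ln t"] by (simp add: power_log_def powr_def mult_ac)

text \<open>For t > 0 and nonzero \<open>s\<close> and \<open>r\<close> this is ln (1 - s + s t^r) /
  (s r), the logarithm of \<open>power_fun s r t\<close> divided by \<open>s\<close>, in a form that
  also makes sense at s = 0 and r = 0.\<close>

definition power_exponent :: "real \<Rightarrow> real \<Rightarrow> real \<Rightarrow> real" where
  "power_exponent s r t = power_log r t * ln_quot (s * (r * power_log r t))"

lemma power_fun_exp:
  assumes "0 \<le> s" "s \<le> 1" "0 < t"
  shows "power_fun s r t = exp (s * power_exponent s r t)"
proof (cases "r = 0")
  case True
  then show ?thesis
    using assms(3) by (simp add: power_fun_def power_exponent_def power_log_zero ln_quot_def powr_def)
next
  case False
  have "r * (s * power_exponent s r t) = (s * (r * power_log r t)) * ln_quot (s * (r * power_log r t))"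
    by (simp add: power_exponent_def mult_ac)
  also have "\<dots> = ln (1 - s + s * t powr r)"
    by (simp add: mult_ln_quot mult_power_log[OF assms(3)] algebra_simps)
  finally have "s * power_exponent s r t = 1 / r * ln (1 - s + s * t powr r)"
    using False by (simp add: field_simps)
  then show ?thesis
    using False power_fun_base_pos[OF assms, of r] by (simp add: power_fun_def powr_def)
qed

text \<open>The difference quotient (f - 1) / s of f = \<open>power_fun s r\<close>, continued to s
  = 0. It goes with the arithmetic bound on \<open>M\<close>.\<close>

definition upper_slope :: "real \<Rightarrow> real \<Rightarrow> real \<Rightarrow> real" where
  "upper_slope s r t = power_exponent s r t * exp_quot (s * power_exponent s r t)"

text \<open>The difference quotient (1 - 1 / f) / s, which goes with the harmonic bound; at s = 0 it
  meets the upper slope.\<close>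

definition lower_slope :: "real \<Rightarrow> real \<Rightarrow> real \<Rightarrow> real" where
  "lower_slope s r t = upper_slope s r t / exp (s * power_exponent s r t)"

lemma mult_upper_slope:
  "0 \<le> s \<Longrightarrow> s \<le> 1 \<Longrightarrow> 0 < t \<Longrightarrow> s * upper_slope s r t = power_fun s r t - 1"
  using mult_exp_quot[of "s * power_exponent s r t"] by (simp add: upper_slope_def power_fun_exp mult_ac)

lemma mult_lower_slope:
  "0 \<le> s \<Longrightarrow> s \<le> 1 \<Longrightarrow> 0 < t \<Longrightarrow> s * lower_slope s r t = 1 - 1 / power_fun s r t"
  using mult_upper_slope[of s t r]
  by (simp add: lower_slope_def power_fun_exp diff_divide_distrib)

lemma upper_slope_zero: "upper_slope 0 r t = power_log r t"
  by (simp add: upper_slope_def power_exponent_def exp_quot_def ln_quot_def)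

lemma lower_slope_zero: "lower_slope 0 r t = power_log r t"
  by (simp add: lower_slope_def upper_slope_zero)

abbreviation (input) param_space :: "(real \<times> real) set" where
  "param_space \<equiv> {0..1} \<times> {-1..1}"

lemma continuous_on_power_log:
  "continuous_on (param_space \<times> {0<..}) (\<lambda>x. power_log (snd (fst x)) (snd x))"
  unfolding power_log_def
  by (intro continuous_intros continuous_on_compose2[OF continuous_on_exp_quot]) auto

lemma continuous_on_power_exponent:
  "continuous_on (param_space \<times> {0<..}) (\<lambda>x. power_exponent (fst (fst x)) (snd (fst x)) (snd x))"
  unfolding power_exponent_def
proof (intro continuous_intros continuous_on_compose2[OF continuous_on_ln_quot] continuous_on_power_log)
  \<comment> \<open>This is positivity of the base \<open>1 - s + s * t powr r\<close>; it keeps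
    \<open>ln_quot\<close> within its domain of continuity.\<close>
  have "-1 < s * (r * power_log r t)" if "0 \<le> s" "s \<le> 1" "0 < t" for s r t
    using power_fun_base_pos[OF that, of r] that(3) by (simp add: mult_power_log algebra_simps)
  then show "(\<lambda>x. fst (fst x) * (snd (fst x) * power_log (snd (fst x)) (snd x))) ` (param_space \<times> {0<..}) \<subseteq> {- 1<..}"
    by auto
qed

lemma continuous_on_upper_slope:
  "continuous_on (param_space \<times> {0<..}) (\<lambda>(p, t). upper_slope (fst p) (snd p) t)"
  unfolding upper_slope_def case_prod_unfold
  by (intro continuous_intros continuous_on_compose2[OF continuous_on_exp_quot] continuous_on_power_exponent) auto

lemma continuous_on_lower_slope:
  "continuous_on (param_space \<times> {0<..}) (\<lambda>(p, t). lower_slope (fst p) (snd p) t)"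
  unfolding lower_slope_def case_prod_unfold
  by (intro continuous_intros continuous_on_power_exponent
      continuous_on_upper_slope[unfolded case_prod_unfold]) auto

lemma continuous_on_power_fun:
  "continuous_on (param_space \<times> {0<..}) (\<lambda>(p, t). power_fun (fst p) (snd p) t)"
proof -
  have "continuous_on (param_space \<times> {0<..}) (\<lambda>(p, t). exp (fst p * power_exponent (fst p) (snd p) t))"
    unfolding case_prod_unfold by (intro continuous_intros continuous_on_power_exponent)
  then show ?thesis
    by (rule continuous_on_cong[THEN iffD1, rotated 2]) (auto simp: power_fun_exp)
qed

text \<open>Diagonalizing unitaries do not depend continuously on the operator. Compactness gives
  them limits along subsequences only, and this criterion turns that into convergence.\<close>

lemma tendsto_by_subsequences:
  fixes X :: "nat \<Rightarrow> 'a::metric_space"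
  assumes "\<And>\<rho> :: nat \<Rightarrow> nat. strict_mono \<rho> \<Longrightarrow> \<exists>\<sigma>. strict_mono \<sigma> \<and> (\<lambda>k. X (\<rho> (\<sigma> k))) \<longlonglongrightarrow> L"
  shows "X \<longlonglongrightarrow> L"
proof (rule ccontr)
  assume "\<not> ?thesis"
  then obtain e where e: "0 < e" "\<not> eventually (\<lambda>k. dist (X k) L < e) sequentially"
    by (auto simp: tendsto_iff)
  then have "infinite {k. \<not> dist (X k) L < e}"
    by (simp add: eventually_cofinite[symmetric] cofinite_eq_sequentially)
  then obtain \<rho> :: "nat \<Rightarrow> nat" where \<rho>: "strict_mono \<rho>" "\<And>n. \<rho> n \<in> {k. \<not> dist (X k) L < e}"
    using infinite_enumerate by metis
  obtain \<sigma> where "(\<lambda>k. X (\<rho> (\<sigma> k))) \<longlonglongrightarrow> L"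
    using assms[OF \<rho>(1)] by blast
  then have "eventually (\<lambda>k. dist (X (\<rho> (\<sigma> k))) L < e) sequentially"
    using e(1) by (rule tendstoD)
  then show False using \<rho>(2) by (auto dest: eventually_happens)
qed

lemma norm_oper_le: "norm A \<le> (\<Sum>i\<in>UNIV. \<Sum>j\<in>UNIV. norm (A $ i $ j))" for A :: "'d::finite oper"
proof -
  have "norm A \<le> (\<Sum>i\<in>UNIV. norm (A $ i))"
    by (simp add: norm_vec_def L2_set_le_sum)
  also have "\<dots> \<le> (\<Sum>i\<in>UNIV. \<Sum>j\<in>UNIV. norm (A $ i $ j))"
    by (intro sum_mono) (simp add: norm_vec_def L2_set_le_sum)
  finally show ?thesis .
qed

lemma bounded_entries:
  fixes S :: "'d::finite oper set"
  assumes "\<And>A i j. A \<in> S \<Longrightarrow> norm (A $ i $ j) \<le> c"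
  shows "bounded S"
proof (rule boundedI)
  fix A assume "A \<in> S"
  then have "(\<Sum>i\<in>UNIV. \<Sum>j\<in>UNIV. norm (A $ i $ j)) \<le> (\<Sum>i\<in>(UNIV :: 'd set). \<Sum>j\<in>(UNIV :: 'd set). c)"
    by (intro sum_mono assms)
  with norm_oper_le[of A] show "norm A \<le> (\<Sum>i\<in>(UNIV :: 'd set). \<Sum>j\<in>(UNIV :: 'd set). c)" by linarith
qed

lemma compact_unitary: "compact {U :: 'd::finite oper. unitary_op U}"
  unfolding compact_eq_bounded_closed
proof
  have "norm (U $ i $ j) \<le> 1" if "unitary_op U" for U :: "'d oper" and i j
  proof -
    have "(U ** cadjoint U) $ i $ i = (\<Sum>k\<in>UNIV. complex_of_real ((norm (U $ i $ k))\<^sup>2))"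
      by (simp add: matrix_matrix_mult_def complex_norm_square[symmetric])
    moreover have "(U ** cadjoint U) $ i $ i = 1"
      using that by (simp add: unitary_op_def mat_def)
    ultimately have "(\<Sum>k\<in>UNIV. (norm (U $ i $ k))\<^sup>2) = 1"
      by (metis of_real_eq_1_iff of_real_sum)
    moreover have "(norm (U $ i $ j))\<^sup>2 \<le> (\<Sum>k\<in>UNIV. (norm (U $ i $ k))\<^sup>2)"
      by (rule member_le_sum) auto
    ultimately show ?thesis by (simp add: power_le_one_iff abs_square_le_1)
  qed
  then show "bounded {U :: 'd oper. unitary_op U}"
    by (intro bounded_entries) auto
  show "closed {U :: 'd oper. unitary_op U}"
    unfolding closed_sequential_limits
  proof (intro allI impI, elim conjE)
    fix U :: "nat \<Rightarrow> 'd oper" and l assume U: "\<forall>n. U n \<in> {U. unitary_op U}" "U \<longlonglongrightarrow> l"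
    have "(\<lambda>n. cadjoint (U n) ** U n) \<longlonglongrightarrow> cadjoint l ** l"
      using U(2) by (intro tendsto_intros)
    moreover have "(\<lambda>n. cadjoint (U n) ** U n) = (\<lambda>n. mat 1)"
      using U(1) by (simp add: unitary_op_def)
    ultimately have "cadjoint l ** l = mat 1"
      by (simp add: LIMSEQ_const_iff)
    then show "l \<in> {U. unitary_op U}" by (simp add: unitary_opI)
  qed
qed

lemma congd_unitary_solve:
  assumes "unitary_op U"
  shows "A = congd U d \<longleftrightarrow> cadjoint U ** A ** U = real_diag d"
proof
  assume "cadjoint U ** A ** U = real_diag d"
  from this[symmetric] show "A = congd U d"
    by (simp add: congd_def matrix_mul_assoc[symmetric] unitary_simps[OF assms])
qed (simp add: congd_def matrix_mul_assoc[symmetric] unitary_simps[OF assms])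

text \<open>Along a subsequence the diagonalizing unitaries converge, and the eigenvalues then converge too.\<close>

lemma fun_calc_tendsto:
  fixes \<phi> :: "'p::metric_space \<Rightarrow> real \<Rightarrow> real" and A :: "nat \<Rightarrow> 'd::finite oper"
  assumes cont: "continuous_on (Q \<times> {0<..}) (\<lambda>(p, t). \<phi> p t)"
    and p: "\<And>k. p k \<in> Q" "q \<in> Q" "p \<longlonglongrightarrow> q"
    and A: "\<And>k. A k \<in> PP" "B \<in> PP" "A \<longlonglongrightarrow> B"
  shows "(\<lambda>k. fun_calc (\<phi> (p k)) (A k)) \<longlonglongrightarrow> fun_calc (\<phi> q) B"
proof (rule tendsto_by_subsequences)
  fix \<rho> :: "nat \<Rightarrow> nat" assume \<rho>: "strict_mono \<rho>"
  have "\<forall>k. \<exists>U d. unitary_op U \<and> (\<forall>i. 0 < d i) \<and> A (\<rho> k) = congd U d"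
  proof
    fix k
    show "\<exists>U d. unitary_op U \<and> (\<forall>i. 0 < d i) \<and> A (\<rho> k) = congd U d"
      by (rule PP_spectral[OF A(1)[of "\<rho> k"]]) blast
  qed
  then obtain U d where U: "\<And>k. unitary_op (U k)" and d: "\<And>k i. 0 < d k i" and Ak: "\<And>k. A (\<rho> k) = congd (U k) (d k)"
    by metis
  obtain V \<sigma> where V: "unitary_op V" and \<sigma>: "strict_mono \<sigma>" and lim: "(\<lambda>k. U (\<sigma> k)) \<longlonglongrightarrow> V"
    using compact_unitary[unfolded compact_def, rule_format, of U] U by (auto simp: o_def)
  have sub: "strict_mono (\<lambda>k. \<rho> (\<sigma> k))"
    using \<rho> \<sigma> by (simp add: strict_mono_def)
  have A_lim: "(\<lambda>k. A (\<rho> (\<sigma> k))) \<longlonglongrightarrow> B" and p_lim: "(\<lambda>k. p (\<rho> (\<sigma> k))) \<longlonglongrightarrow> q"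
    using LIMSEQ_subseq_LIMSEQ[OF A(3) sub] LIMSEQ_subseq_LIMSEQ[OF p(3) sub] by (simp_all add: o_def)
  have D_lim: "(\<lambda>k. real_diag (d (\<sigma> k))) \<longlonglongrightarrow> cadjoint V ** B ** V"
  proof -
    have "real_diag (d (\<sigma> k)) = cadjoint (U (\<sigma> k)) ** A (\<rho> (\<sigma> k)) ** U (\<sigma> k)" for k
      using congd_unitary_solve[OF U, THEN iffD1, OF Ak] by simp
    then show ?thesis
      by (simp only:) (intro tendsto_intros lim A_lim)
  qed
  define e where "e i = Re ((cadjoint V ** B ** V) $ i $ i)" for i
  have d_lim: "(\<lambda>k. d (\<sigma> k) i) \<longlonglongrightarrow> e i" for i
    using tendsto_Re[OF tendsto_vec_nth[OF tendsto_vec_nth[OF D_lim]], of i i]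
    by (simp add: e_def real_diag_def)
  have "cadjoint V ** B ** V = real_diag e"
    by (rule LIMSEQ_unique[OF D_lim]) (intro tendsto_intros d_lim)
  then have B: "B = congd V e"
    using congd_unitary_solve[OF V] by blast
  \<comment> \<open>Continuity of \<phi> is known only at positive arguments; positive definiteness
    of \<open>B\<close> keeps the limit eigenvalues there.\<close>
  have e: "0 < e i" for i
    using PP_pos_definite[OF A(2) dual_axis_nonzero[OF invertible_unitary[OF V], of i]]
    by (simp add: B congd_inner_dual_axis[OF invertible_unitary[OF V]])
  have "(\<lambda>k. (\<lambda>(p, t). \<phi> p t) (p (\<rho> (\<sigma> k)), d (\<sigma> k) i)) \<longlonglongrightarrow> (\<lambda>(p, t). \<phi> p t) (q, e i)" for i
    by (rule continuous_on_tendsto_compose[OF cont tendsto_Pair[OF p_lim d_lim]]) (auto simp: p d e)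
  then have "(\<lambda>k. \<phi> (p (\<rho> (\<sigma> k))) (d (\<sigma> k) i)) \<longlonglongrightarrow> \<phi> q (e i)" for i by simp
  then have "(\<lambda>k. congd (U (\<sigma> k)) (\<lambda>i. \<phi> (p (\<rho> (\<sigma> k))) (d (\<sigma> k) i))) \<longlonglongrightarrow> congd V (\<lambda>i. \<phi> q (e i))"
    unfolding congd_def by (intro tendsto_intros lim)
  then have "(\<lambda>k. fun_calc (\<phi> (p (\<rho> (\<sigma> k)))) (A (\<rho> (\<sigma> k)))) \<longlonglongrightarrow> fun_calc (\<phi> q) B"
    by (simp add: Ak B fun_calc_congd[OF U] fun_calc_congd[OF V])
  with \<sigma> show "\<exists>\<sigma>. strict_mono \<sigma> \<and>
      (\<lambda>k. fun_calc (\<phi> (p (\<rho> (\<sigma> k)))) (A (\<rho> (\<sigma> k)))) \<longlonglongrightarrow> fun_calc (\<phi> q) B"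
    by blast
qed

lemma op_powr_tendsto:
  assumes "\<And>k. X k \<in> PP" "Y \<in> PP" "X \<longlonglongrightarrow> Y"
  shows "(\<lambda>k. op_powr (X k) c) \<longlonglongrightarrow> op_powr Y c"
proof -
  have "continuous_on ((UNIV :: real set) \<times> {0<..}) (\<lambda>(p, t). t powr c)"
    unfolding case_prod_unfold by (intro continuous_intros) auto
  from fun_calc_tendsto[OF this, of "\<lambda>_. 0" 0 X Y] assms show ?thesis
    by (simp add: op_powr_def)
qed

lemma ka_mean_tendsto:
  fixes \<phi> :: "'p::metric_space \<Rightarrow> real \<Rightarrow> real"
  assumes "continuous_on (Q \<times> {0<..}) (\<lambda>(p, t). \<phi> p t)"
    and "\<And>k. p k \<in> Q" "q \<in> Q" "p \<longlonglongrightarrow> q"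
    and X: "\<And>k. X k \<in> PP" "Y \<in> PP" "X \<longlonglongrightarrow> Y" and "A \<in> PP"
  shows "(\<lambda>k. ka_mean (\<phi> (p k)) (X k) A) \<longlonglongrightarrow> ka_mean (\<phi> q) Y A"
proof -
  have PP: "op_powr X (-1/2) ** A ** op_powr X (-1/2) \<in> PP" if "X \<in> PP" for X
  proof -
    have "invertible (op_powr X (-1/2))"
      unfolding invertible_def using op_powr_half[OF that] by blast
    from PP_congruence[OF \<open>A \<in> PP\<close> this] show ?thesis
      by (simp only: op_powr_half(2)[OF that])
  qed
  show ?thesis
    unfolding ka_mean_def
    by (intro tendsto_matrix_mult fun_calc_tendsto[OF assms(1-4)] op_powr_tendsto tendsto_const PP X)
qed

section \<open>Uniqueness of solutions\<close>

lemma ka_mean_cong: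
  assumes "X \<in> PP" "A \<in> PP" "\<And>t. 0 < t \<Longrightarrow> f t = g t"
  shows "ka_mean f X A = ka_mean g X A"
proof -
  obtain T d where "invertible T" "\<And>i. 0 < d i" "X = congd T (\<lambda>i. 1)" "A = congd T d"
    using simultaneous_diagonalization[OF assms(1,2)] by blast
  then show ?thesis using assms(3) by (simp add: ka_mean_congd_one)
qed

text \<open>The constant function 1 represents the left trivial mean. Here \<open>f\<close> may
  change sign, as \<open>power_log\<close> does.\<close>

lemma ka_mean_affine:
  assumes "X \<in> PP" "A \<in> PP"
  shows "ka_mean (\<lambda>t. a * f t + b) X A = a *\<^sub>R ka_mean f X A + b *\<^sub>R X"
proof -
  obtain T d where "invertible T" "\<And>i. 0 < d i" "X = congd T (\<lambda>i. 1)" "A = congd T d"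
    using simultaneous_diagonalization[OF assms] by blast
  then show ?thesis by (simp add: ka_mean_congd_one congd_scaleR congd_add)
qed

text \<open>Keeping \<open>X\<close> and \<open>A\<close> as arguments, instead of their inverses,
  makes harmonic expressions arithmetic after a congruence by \<open>X\<close>.\<close>

lemma matrix_inv_ka_mean_congruence:
  assumes "X \<in> PP" "A \<in> PP" "\<And>t. 0 < t \<Longrightarrow> 0 < f t"
  shows "matrix_inv (ka_mean f X A) = matrix_inv X ** ka_mean (\<lambda>t. 1 / f t) X A ** matrix_inv X"
proof -
  obtain T d where T: "invertible T" and d: "\<And>i. 0 < d i" and X: "X = congd T (\<lambda>i. 1)" and A: "A = congd T d"
    using simultaneous_diagonalization[OF assms(1,2)] by blast
  have "f (d i) \<noteq> 0" for i using assms(3)[OF d[of i]] by simp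
  then show ?thesis
    by (simp add: X A ka_mean_congd_one[OF T] matrix_inv_congd[OF T])
       (simp add: congd_def real_diag_one matrix_mul_assoc[symmetric] dual_simps[OF T])
qed

lemma congruence_arith_mean:
  "S ** arith_mean w B ** S' = arith_mean w (\<lambda>j. S ** B j ** S')" for S :: "'d::finite oper"
proof -
  have "S ** (\<Sum>j\<in>J. w j *\<^sub>R B j) ** S' = (\<Sum>j\<in>J. w j *\<^sub>R (S ** B j ** S'))" for J
    by (induction J rule: infinite_finite_induct)
      (simp_all add: matrix_add_ldistrib mat_add_rdistrib mat_scaleR_left mat_scaleR_right)
  then show ?thesis by (simp add: arith_mean_def)
qed

lemma inner_arith_mean: "x \<bullet> (arith_mean w B *v x) = (\<Sum>j\<in>UNIV. w j * (x \<bullet> (B j *v x)))"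
proof -
  have "(\<Sum>j\<in>J. w j *\<^sub>R B j) *v x = (\<Sum>j\<in>J. w j *\<^sub>R (B j *v x))" for J
    by (induction J rule: infinite_finite_induct) (simp_all add: matrix_vector_mult_add_rdistrib scaleR_mat_vec)
  then show ?thesis by (simp add: arith_mean_def inner_sum_right)
qed

lemma arith_mean_mono: "weight_vector w \<Longrightarrow> (\<And>j. A j \<preceq> B j) \<Longrightarrow> arith_mean w A \<preceq> arith_mean w B"
  by (simp add: arith_mean_def weight_vector_def op_le_sum op_le_scaleR)

lemma arith_mean_PP:
  assumes "weight_vector w" "\<And>j. A j \<in> PP"
  shows "arith_mean w A \<in> PP"
proof (rule PP_I)
  have "cadjoint (\<Sum>j\<in>J. w j *\<^sub>R A j) = (\<Sum>j\<in>J. w j *\<^sub>R A j)" for J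
    using PP_selfadjoint[OF assms(2), unfolded selfadjoint_op_def]
    by (induction J rule: infinite_finite_induct) (simp_all add: cadjoint_add cadjoint_scaleR, simp_all add: vec_eq_iff)
  then show "selfadjoint_op (arith_mean w A)"
    by (simp add: selfadjoint_op_def arith_mean_def)
  fix x :: "complex^'b" assume x: "x \<noteq> 0"
  have w: "0 \<le> w j" "(\<Sum>j\<in>UNIV. w j) = 1" for j
    using assms(1) by (simp_all add: weight_vector_def)
  then obtain i where "w i \<noteq> 0" by (metis sum.neutral zero_neq_one)
  then have "0 < w i" using w(1)[of i] by simp
  then show "0 < x \<bullet> (arith_mean w A *v x)"
    unfolding inner_arith_mean using w PP_pos_definite[OF assms(2) x]
    by (intro sum_pos2[of _ i]) (auto simp: less_imp_le)
qed

lemma arith_mean_affine: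
  assumes "weight_vector w"
  shows "arith_mean w (\<lambda>j. a *\<^sub>R B j + b *\<^sub>R X) = a *\<^sub>R arith_mean w B + b *\<^sub>R X"
proof -
  have "(\<Sum>j\<in>UNIV. w j *\<^sub>R (b *\<^sub>R X)) = b *\<^sub>R X"
    using assms by (simp only: scaleR_sum_left[symmetric] weight_vector_def scaleR_one)
  then show ?thesis
    by (simp add: arith_mean_def scaleR_add_right sum.distrib scaleR_sum_right mult.commute)
qed

lemma arith_mean_scaleR: "arith_mean w (\<lambda>j. a *\<^sub>R B j) = a *\<^sub>R arith_mean w B"
  by (simp add: arith_mean_def scaleR_sum_right mult.commute)

lemma joint_monotone_arith_mean: "weight_vector w \<Longrightarrow> joint_monotone (arith_mean w)"
  by (simp add: joint_monotone_def arith_mean_mono)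

lemma pos_homogeneous_arith_mean: "pos_homogeneous (arith_mean w)"
  by (simp add: pos_homogeneous_def arith_mean_scaleR)

lemma harm_mean_eq: "harm_mean w A = matrix_inv (arith_mean w (\<lambda>j. matrix_inv (A j)))"
  by (simp add: harm_mean_def arith_mean_def)

lemma joint_monotone_harm_mean:
  assumes "weight_vector w"
  shows "joint_monotone (harm_mean w)"
  unfolding joint_monotone_def harm_mean_eq
  using assms by (auto intro!: matrix_inv_antimono arith_mean_PP arith_mean_mono matrix_inv_PP)

lemma matrix_inv_scaleR:
  fixes A :: "'d::finite oper"
  assumes "invertible A" "c \<noteq> 0"
  shows "matrix_inv (c *\<^sub>R A) = (1 / c) *\<^sub>R matrix_inv A"
  using assms by (intro matrix_inv_eqI) (simp add: mat_scaleR_left mat_scaleR_right matrix_inv_mult)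

lemma pos_homogeneous_harm_mean:
  assumes "weight_vector w"
  shows "pos_homogeneous (harm_mean w)"
  unfolding pos_homogeneous_def
proof (intro allI impI)
  fix c :: real and A :: "'a \<Rightarrow> 'b oper" assume c: "0 < c" and A: "\<forall>j. A j \<in> PP"
  have inv: "invertible B" if "B \<in> PP" for B :: "'b oper"
    using that by (simp add: PP_def)
  have "arith_mean w (\<lambda>j. matrix_inv (A j)) \<in> PP"
    using assms A by (intro arith_mean_PP matrix_inv_PP) auto
  then show "harm_mean w (\<lambda>j. c *\<^sub>R A j) = c *\<^sub>R harm_mean w A"
    using c A by (simp add: harm_mean_eq matrix_inv_scaleR inv arith_mean_scaleR)
qed

text \<open>As \<open>f\<close> increases strictly, passing from \<open>Y\<close> to \<alpha> times
  \<open>Y\<close> multiplies each inner mean by less than \<alpha>; monotonicity and homogeneity of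
  \<open>M\<close> then improve the touching factor. This serves the deformed means and, with
  \<open>f\<close> a power and \<open>M\<close> the arithmetic or harmonic mean, the power
  means.\<close>

lemma fixed_point_le:
  fixes M :: "('n::finite \<Rightarrow> 'd::finite oper) \<Rightarrow> 'd oper"
  assumes M: "joint_monotone M" "pos_homogeneous M"
    and mono: "mean_monotone (ka_mean f :: 'd oper \<Rightarrow> _)"
    and pos: "\<And>t. 0 < t \<Longrightarrow> 0 < f t" and strict: "\<And>t u. 0 < t \<Longrightarrow> t < u \<Longrightarrow> f t < f u"
    and A: "\<And>j. A j \<in> PP"
    and X: "X \<in> PP" "X = M (\<lambda>j. ka_mean f X (A j))"
    and Y: "Y \<in> PP" "Y = M (\<lambda>j. ka_mean f Y (A j))"
  shows "X \<preceq> Y"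
proof (rule op_le_by_touching[OF X(1) Y(1)])
  fix \<alpha> v assume \<alpha>: "1 < \<alpha>" "v \<noteq> 0" "X \<preceq> \<alpha> *\<^sub>R Y" "X *v v = \<alpha> *\<^sub>R (Y *v v)"
  have aY: "\<alpha> *\<^sub>R Y \<in> PP" using \<alpha>(1) Y(1) by (intro PP_scaleR) auto
  note kPP = ka_mean_PP[OF _ A pos]
  have "\<exists>b. 0 < b \<and> b < \<alpha> \<and> ka_mean f (\<alpha> *\<^sub>R Y) (A j) \<preceq> b *\<^sub>R ka_mean f Y (A j)" for j
  proof -
    obtain T d where T: "invertible T" and d: "\<And>i. 0 < d i" and YT: "Y = congd T (\<lambda>i. 1)" and AT: "A j = congd T d"
      using simultaneous_diagonalization[OF Y(1) A[of j]] by blast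
    \<comment> \<open>The ratio of the means with left arguments \<alpha> times \<open>Y\<close> and
      \<open>Y\<close>, in the i-th common direction.\<close>
    define q where "q i = \<alpha> * f (d i / \<alpha>) / f (d i)" for i
    have q: "0 < q i" "q i < \<alpha>" for i
    proof -
      have "d i / \<alpha> < d i" using d[of i] \<alpha>(1) by (simp add: divide_less_eq)
      then have "f (d i / \<alpha>) < f (d i)" using strict[of "d i / \<alpha>" "d i"] d[of i] \<alpha>(1) by simp
      then show "q i < \<alpha>" using pos[OF d[of i]] \<alpha>(1) by (simp add: q_def divide_less_eq)
      show "0 < q i" using pos[OF d[of i]] pos[of "d i / \<alpha>"] d[of i] \<alpha>(1) by (simp add: q_def)
    qed
    define b where "b = Max (range q)"
    have "b \<in> range q" unfolding b_def by (rule Max_in) auto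
    then have "0 < b" "b < \<alpha>" using q by auto
    moreover have "\<alpha> * f (d i / \<alpha>) \<le> b * f (d i)" for i
    proof -
      have "q i \<le> b" unfolding b_def by (rule Max_ge) auto
      then show ?thesis using pos[OF d[of i]] by (simp add: q_def divide_le_eq)
    qed
    then have "ka_mean f (\<alpha> *\<^sub>R Y) (A j) \<preceq> b *\<^sub>R ka_mean f Y (A j)"
      using \<alpha>(1) by (simp add: YT AT congd_scaleR ka_mean_congd[OF T] congd_le_iff[OF T])
    ultimately show ?thesis by blast
  qed
  then obtain b where b: "\<And>j. 0 < b j" "\<And>j. b j < \<alpha>"
    "\<And>j. ka_mean f (\<alpha> *\<^sub>R Y) (A j) \<preceq> b j *\<^sub>R ka_mean f Y (A j)"
    by metis
  \<comment> \<open>As there are finitely many indices, one common factor still lies below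
    \<alpha>.\<close>
  define \<beta> where "\<beta> = Max (range b)"
  have "\<beta> \<in> range b" unfolding \<beta>_def by (rule Max_in) auto
  then have \<beta>: "0 < \<beta>" "\<beta> < \<alpha>" using b by auto
  have "ka_mean f X (A j) \<preceq> \<beta> *\<^sub>R ka_mean f Y (A j)" for j
  proof -
    have "ka_mean f X (A j) \<preceq> ka_mean f (\<alpha> *\<^sub>R Y) (A j)"
      by (rule mean_monotoneD[OF mono]) (use X(1) aY A \<alpha>(3) in auto)
    moreover have "b j \<le> \<beta>" unfolding \<beta>_def by (rule Max_ge) auto
    then have "b j *\<^sub>R ka_mean f Y (A j) \<preceq> \<beta> *\<^sub>R ka_mean f Y (A j)"
      by (intro scaleR_le_scaleR kPP Y(1))
    ultimately show ?thesis using b(3)[of j] op_le_trans by blast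
  qed
  moreover have "ka_mean f X (A j) \<in> PP" "\<beta> *\<^sub>R ka_mean f Y (A j) \<in> PP" for j
    using kPP X(1) Y(1) \<beta>(1) by (auto intro: PP_scaleR)
  ultimately have "M (\<lambda>j. ka_mean f X (A j)) \<preceq> M (\<lambda>j. \<beta> *\<^sub>R ka_mean f Y (A j))"
    using M(1) by (simp add: joint_monotone_def)
  also have "M (\<lambda>j. \<beta> *\<^sub>R ka_mean f Y (A j)) = \<beta> *\<^sub>R M (\<lambda>j. ka_mean f Y (A j))"
    using M(2) \<beta>(1) kPP[OF Y(1)] by (simp add: pos_homogeneous_def)
  finally have "X \<preceq> \<beta> *\<^sub>R Y"
    by (simp only: X(2)[symmetric] Y(2)[symmetric])
  then have "\<alpha> \<le> \<beta>" by (rule touching_factor_le[OF \<alpha>(4,2) Y(1)])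
  with \<beta>(2) show False by simp
qed

section \<open>The equations at s = 0\<close>

lemma ka_mean_power_log:
  assumes "X \<in> PP" "A \<in> PP" "r \<noteq> 0"
  shows "ka_mean (power_log r) X A = (1 / r) *\<^sub>R (ka_mean (\<lambda>t. t powr r) X A - X)"
proof -
  have "ka_mean (power_log r) X A = ka_mean (\<lambda>t. (1 / r) * t powr r + - (1 / r)) X A"
  proof (rule ka_mean_cong[OF assms(1,2)])
    show "power_log r t = (1 / r) * t powr r + - (1 / r)" if "0 < t" for t
      using mult_power_log[OF that, of r] assms(3) by (simp add: field_simps)
  qed
  then show ?thesis
    using ka_mean_affine[OF assms(1,2), of "1 / r" _ "- (1 / r)"] by (simp add: scaleR_diff_right)
qed

lemma arith_ka_power_log:
  assumes "weight_vector w" "X \<in> PP" "\<And>j. A j \<in> PP" "r \<noteq> 0"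
  shows "arith_mean w (\<lambda>j. ka_mean (power_log r) X (A j)) =
    (1 / r) *\<^sub>R (arith_mean w (\<lambda>j. ka_mean (\<lambda>t. t powr r) X (A j)) - X)"
  using arith_mean_affine[OF assms(1), of "1 / r" _ "- (1 / r)" X] assms
  by (simp add: ka_mean_power_log scaleR_diff_right)

lemma power_mean_equation_pos:
  assumes "weight_vector w" "X \<in> PP" "\<And>j. A j \<in> PP" "0 < r"
  shows "X = arith_mean w (\<lambda>j. geo_mean r X (A j)) \<longleftrightarrow>
    arith_mean w (\<lambda>j. ka_mean (power_log r) X (A j)) = 0"
  using assms by (auto simp: arith_ka_power_log geo_mean_def)

text \<open>The inverse of X #_(-r) A_j is the mean with function t^r between two factors X^(-1).
  After inverting both sides these factors cancel, which leaves the same arithmetic equation as for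
  r > 0.\<close>

lemma power_mean_equation_neg:
  assumes w: "weight_vector w" and X: "X \<in> PP" and A: "\<And>j. A j \<in> PP" and r: "r < 0"
  shows "X = harm_mean w (\<lambda>j. geo_mean (- r) X (A j)) \<longleftrightarrow>
    arith_mean w (\<lambda>j. ka_mean (power_log r) X (A j)) = 0"
proof -
  let ?H = "arith_mean w (\<lambda>j. ka_mean (\<lambda>t. t powr r) X (A j))"
  have inv: "invertible X" using X by (simp add: PP_def)
  note XX = matrix_inv_mult[OF inv]
  have "matrix_inv (geo_mean (- r) X (A j)) = matrix_inv X ** ka_mean (\<lambda>t. t powr r) X (A j) ** matrix_inv X" for j
    unfolding geo_mean_def
    by (subst matrix_inv_ka_mean_congruence[OF X A]) (simp_all add: powr_minus_divide)
  then have h: "harm_mean w (\<lambda>j. geo_mean (- r) X (A j)) = matrix_inv (matrix_inv X ** ?H ** matrix_inv X)"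
    by (simp add: harm_mean_eq congruence_arith_mean)
  have H: "?H \<in> PP" by (intro arith_mean_PP w ka_mean_PP X A) simp
  have "matrix_inv X ** ?H ** cadjoint (matrix_inv X) \<in> PP"
    using XX by (intro PP_congruence[OF H]) (auto simp: invertible_def)
  moreover have "cadjoint (matrix_inv X) = matrix_inv X"
    using PP_selfadjoint[OF matrix_inv_PP(1)[OF X]] by (simp add: selfadjoint_op_def)
  ultimately have HP: "matrix_inv X ** ?H ** matrix_inv X \<in> PP" by simp
  have "X = harm_mean w (\<lambda>j. geo_mean (- r) X (A j)) \<longleftrightarrow> matrix_inv X = matrix_inv X ** ?H ** matrix_inv X"
    unfolding h using matrix_inv_PP(2)[OF X] matrix_inv_PP(2)[OF HP] by metis
  also have "\<dots> \<longleftrightarrow> X = ?H"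
  proof
    assume "matrix_inv X = matrix_inv X ** ?H ** matrix_inv X"
    then have "X ** matrix_inv X ** X = X ** (matrix_inv X ** ?H ** matrix_inv X) ** X" by simp
    then show "X = ?H"
      by (simp add: matrix_mul_assoc[symmetric] XX mult_cancel_left)
  next
    assume "X = ?H"
    then have "matrix_inv X ** ?H ** matrix_inv X = matrix_inv X ** X ** matrix_inv X" by simp
    then show "matrix_inv X = matrix_inv X ** ?H ** matrix_inv X" by (simp add: XX)
  qed
  finally show ?thesis using r w X A by (auto simp: arith_ka_power_log)
qed

lemma mat_mult_zero: "A ** 0 = 0" "0 ** A = 0" for A :: "'d::finite oper"
  by (simp_all add: vec_eq_iff matrix_matrix_mult_def)

text \<open>Congruence by X^(1/2) passes through the weighted sum and is injective.\<close>

lemma karcher_equation: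
  assumes X: "X \<in> PP"
  shows "(\<Sum>j\<in>UNIV. w j *\<^sub>R op_log (op_powr X (-1/2) ** A j ** op_powr X (-1/2))) = 0 \<longleftrightarrow>
    arith_mean w (\<lambda>j. ka_mean (power_log 0) X (A j)) = 0"
proof -
  let ?P = "op_powr X (1/2)" and ?R = "op_powr X (-1/2)"
  let ?L = "arith_mean w (\<lambda>j. op_log (?R ** A j ** ?R))"
  have "power_log 0 = ln" by (simp add: fun_eq_iff power_log_zero)
  then have "arith_mean w (\<lambda>j. ka_mean (power_log 0) X (A j)) = ?P ** ?L ** ?P"
    by (simp only: ka_mean_def op_log_def congruence_arith_mean)
  moreover have L: "?L = ?R ** (?P ** ?L ** ?P) ** ?R"
    by (simp only: matrix_mul_assoc[symmetric] op_powr_half[OF X] mult_cancel_left matrix_mul_rid)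
  have "?L = 0 \<longleftrightarrow> ?P ** ?L ** ?P = 0"
  proof
    assume "?L = 0"
    then show "?P ** ?L ** ?P = 0" by (simp only: mat_mult_zero)
  next
    assume z: "?P ** ?L ** ?P = 0"
    show "?L = 0" by (subst L) (simp only: z mat_mult_zero)
  qed
  ultimately show ?thesis by (simp add: arith_mean_def)
qed

text \<open>For \<alpha> > 1 the extra multiple of \<open>Y\<close> is negative; it decides the
  comparison of Karcher solutions.\<close>

lemma ka_mean_power_log_zero_scaleR:
  assumes "Y \<in> PP" "A \<in> PP" "0 < \<alpha>"
  shows "ka_mean (power_log 0) (\<alpha> *\<^sub>R Y) A = \<alpha> *\<^sub>R ka_mean (power_log 0) Y A + (- (\<alpha> * ln \<alpha>)) *\<^sub>R Y"
proof -
  obtain T d where T: "invertible T" and d: "\<And>i. 0 < d i" and YT: "Y = congd T (\<lambda>i. 1)" and AT: "A = congd T d"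
    using simultaneous_diagonalization[OF assms(1,2)] by blast
  have "\<alpha> * ln (d i / \<alpha>) = \<alpha> * ln (d i) + - (\<alpha> * ln \<alpha>)" for i
    using d[of i] assms(3) by (simp add: ln_div algebra_simps)
  then show ?thesis
    unfolding YT AT congd_scaleR congd_add power_log_zero[abs_def]
    using assms(3) by (simp add: ka_mean_congd[OF T] congd_scaleR congd_add power_log_zero)
qed

text \<open>Limit \<open>r \<rightarrow> 0\<close> of the monotone map \<open>X \<mapsto> (X #\<^sub>r A - X) / r\<close>; the term \<open>- X / r\<close> is harmless because
  \<open>X\<close> and \<open>Z\<close> agree at \<open>v\<close>.\<close>

lemma touching_ka_mean_log:
  assumes PP: "X \<in> PP" "Z \<in> PP" "A \<in> PP" and le: "X \<preceq> Z" and eq: "X *v v = Z *v v"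
  shows "v \<bullet> (ka_mean (power_log 0) X A *v v) \<le> v \<bullet> (ka_mean (power_log 0) Z A *v v)"
proof -
  define r :: "nat \<Rightarrow> real" where "r k = inverse (real (Suc k))" for k
  have r: "0 < r k" "r k \<le> 1" for k by (simp_all add: r_def inverse_le_1_iff)
  have lim: "(\<lambda>k. ka_mean (power_log (r k)) B A) \<longlonglongrightarrow> ka_mean (power_log 0) B A" if "B \<in> PP" for B
  proof -
    have "continuous_on (param_space \<times> {0<..}) (\<lambda>(p, t). power_log (snd p) t)"
      using continuous_on_power_log by (simp add: case_prod_unfold)
    moreover have "(0, r k) \<in> param_space" for k using r[of k] by simp
    moreover have "(\<lambda>k. (0, r k)) \<longlonglongrightarrow> (0, 0)"
      unfolding r_def by (intro tendsto_intros LIMSEQ_inverse_real_of_nat)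
    ultimately show ?thesis
      using ka_mean_tendsto[of param_space "\<lambda>p. power_log (snd p)" "\<lambda>k. (0, r k)" "(0, 0)" "\<lambda>_. B" B A] that PP(3)
      by simp
  qed
  have "v \<bullet> (ka_mean (power_log (r k)) X A *v v) \<le> v \<bullet> (ka_mean (power_log (r k)) Z A *v v)" for k
  proof -
    have "geo_mean (r k) X A \<preceq> geo_mean (r k) Z A"
      using r[of k] by (intro mean_monotoneD[OF geo_mean_monotone] PP le) auto
    then have "v \<bullet> (geo_mean (r k) X A *v v) - v \<bullet> (X *v v) \<le> v \<bullet> (geo_mean (r k) Z A *v v) - v \<bullet> (Z *v v)"
      using op_le_inner eq by fastforce
    then show ?thesis
      using r(1)[of k] PP
      by (simp add: ka_mean_power_log less_imp_neq[symmetric] scaleR_mat_vec matrix_vector_mult_diff_rdistrib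
          inner_diff_right geo_mean_def divide_right_mono)
  qed
  moreover have "(\<lambda>k. v \<bullet> (ka_mean (power_log (r k)) B A *v v)) \<longlonglongrightarrow> v \<bullet> (ka_mean (power_log 0) B A *v v)"
    if "B \<in> PP" for B
    by (intro tendsto_intros lim that)
  ultimately show ?thesis
    using LIMSEQ_le[of _ "v \<bullet> (ka_mean (power_log 0) X A *v v)"] PP(1,2) by blast
qed

text \<open>\<open>fixed_point_le\<close> asks for a positive function and so does not cover ln. At
  a touching vector the two equations compare to 0 \<le> - \<alpha> ln \<alpha> times the form of
  \<open>Y\<close>, impossible for \<alpha> > 1.\<close>

lemma karcher_le:
  assumes w: "weight_vector w" and A: "\<And>j. A j \<in> PP"
    and X: "X \<in> PP" "arith_mean w (\<lambda>j. ka_mean (power_log 0) X (A j)) = 0"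
    and Y: "Y \<in> PP" "arith_mean w (\<lambda>j. ka_mean (power_log 0) Y (A j)) = 0"
  shows "X \<preceq> Y"
proof (rule op_le_by_touching[OF X(1) Y(1)])
  fix \<alpha> v assume \<alpha>: "1 < \<alpha>" "v \<noteq> 0" "X \<preceq> \<alpha> *\<^sub>R Y" "X *v v = \<alpha> *\<^sub>R (Y *v v)"
  define Z where "Z = \<alpha> *\<^sub>R Y"
  have Z: "Z \<in> PP" using \<alpha>(1) Y(1) by (auto simp: Z_def intro: PP_scaleR)
  have "v \<bullet> (ka_mean (power_log 0) X (A j) *v v) \<le> v \<bullet> (ka_mean (power_log 0) Z (A j) *v v)" for j
    using \<alpha>(3,4) by (intro touching_ka_mean_log X(1) Z A) (simp_all add: Z_def scaleR_mat_vec)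
  then have "v \<bullet> (arith_mean w (\<lambda>j. ka_mean (power_log 0) X (A j)) *v v)
      \<le> v \<bullet> (arith_mean w (\<lambda>j. ka_mean (power_log 0) Z (A j)) *v v)"
    using w unfolding inner_arith_mean weight_vector_def by (intro sum_mono mult_left_mono) auto
  also have "arith_mean w (\<lambda>j. ka_mean (power_log 0) Z (A j)) = (- (\<alpha> * ln \<alpha>)) *\<^sub>R Y"
    using \<alpha>(1) A Y arith_mean_affine[OF w, of \<alpha> _ "- (\<alpha> * ln \<alpha>)" Y]
    by (simp add: Z_def ka_mean_power_log_zero_scaleR)
  finally have "0 \<le> - (\<alpha> * ln \<alpha>) * (v \<bullet> (Y *v v))"
    by (simp only: X(2) scaleR_mat_vec inner_scaleR_right matrix_vector_mult_0 inner_zero_right)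
  moreover have "0 < \<alpha> * ln \<alpha> * (v \<bullet> (Y *v v))"
    using \<alpha>(1) PP_pos_definite[OF Y(1) \<alpha>(2)] by simp
  ultimately show False by simp
qed

lemma power_log_equation_le:
  assumes w: "weight_vector w" and A: "\<And>j. A j \<in> PP" and r: "-1 \<le> r" "r \<le> 1"
    and X: "X \<in> PP" "arith_mean w (\<lambda>j. ka_mean (power_log r) X (A j)) = 0"
    and Y: "Y \<in> PP" "arith_mean w (\<lambda>j. ka_mean (power_log r) Y (A j)) = 0"
  shows "X \<preceq> Y"
proof -
  consider "0 < r" | "r = 0" | "r < 0" by linarith
  then show ?thesis
  proof cases
    case 1
    note eq = power_mean_equation_pos[OF w _ A 1, THEN iffD2, unfolded geo_mean_def]
    show ?thesis
      using geo_mean_monotone[of r] 1 r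
      by (intro fixed_point_le[OF joint_monotone_arith_mean[OF w] pos_homogeneous_arith_mean _
            _ powr_less_mono2[OF 1 less_imp_le] A X(1) eq[OF X] Y(1) eq[OF Y]]) (simp_all add: geo_mean_def)
  next
    case 2
    then show ?thesis using karcher_le[OF w A] X Y by simp
  next
    case 3
    then have 3: "r < 0" "0 < - r" by auto
    \<comment> \<open>For r < 0 the function t^r decreases, so the equation is first returned to its
      harmonic form with exponent \<open>- r\<close>.\<close>
    note eq = power_mean_equation_neg[OF w _ A 3(1), THEN iffD2, unfolded geo_mean_def]
    show ?thesis
      using geo_mean_monotone[of "- r"] 3 r
      by (intro fixed_point_le[OF joint_monotone_harm_mean[OF w] pos_homogeneous_harm_mean[OF w] _
            _ powr_less_mono2[OF 3(2) less_imp_le] A X(1) eq[OF X] Y(1) eq[OF Y]]) (simp_all add: geo_mean_def)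
  qed
qed

section \<open>Continuity of the deformed family\<close>

lemma inner_scaled_identity: "x \<bullet> ((c *\<^sub>R mat 1) *v x) = c * (norm x)\<^sup>2" for x :: "complex ^ 'd::finite"
  by (simp add: scaleR_mat_vec power2_norm_eq_inner)

lemma scaled_identity_congd: "c *\<^sub>R mat 1 = congd (mat 1) (\<lambda>i. c)"
  using congd_scaleR[of c "mat 1" "\<lambda>i. 1"] by (simp add: congd_one)

lemma invertible_mat_one: "invertible (mat 1 :: 'd::finite oper)"
  unfolding invertible_def by (rule exI[of _ "mat 1"]) simp

lemma PP_bounds:
  assumes "A \<in> PP"
  obtains m K where "0 < m" "m \<le> K" "m *\<^sub>R mat 1 \<preceq> A" "A \<preceq> K *\<^sub>R mat 1"
proof -
  obtain U d where U: "unitary_op U" and d: "\<And>i. 0 < d i" and A: "A = congd U d"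
    using PP_spectral[OF assms] by blast
  have "Min (range d) \<in> range d" by (rule Min_in) auto
  then have m: "0 < Min (range d)" using d by auto
  have le: "Min (range d) \<le> d i" "d i \<le> Max (range d)" for i by (auto intro: Min_le Max_ge)
  have "c *\<^sub>R mat 1 = congd U (\<lambda>i. c)" for c
    using congd_scaleR[of c U "\<lambda>i. 1"] by (simp add: congd_one unitary_simps[OF U])
  then have "Min (range d) *\<^sub>R mat 1 \<preceq> A" "A \<preceq> Max (range d) *\<^sub>R mat 1"
    by (simp_all add: A congd_le_iff[OF invertible_unitary[OF U]] le)
  with m that show thesis using le order_trans by blast
qed

lemma PP_family_bounds:
  fixes A :: "'n::finite \<Rightarrow> 'd::finite oper"
  assumes "\<And>j. A j \<in> PP"
  obtains m K where "0 < m" "m \<le> K" "\<And>j. m *\<^sub>R mat 1 \<preceq> A j" "\<And>j. A j \<preceq> K *\<^sub>R mat 1"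
proof -
  have "\<forall>j. \<exists>m K. 0 < m \<and> m \<le> K \<and> m *\<^sub>R mat 1 \<preceq> A j \<and> A j \<preceq> K *\<^sub>R mat 1"
  proof
    show "\<exists>m K. 0 < m \<and> m \<le> K \<and> m *\<^sub>R mat 1 \<preceq> A j \<and> A j \<preceq> K *\<^sub>R mat 1" for j
      by (rule PP_bounds[OF assms[of j]]) blast
  qed
  then obtain m K where mK: "\<And>j. 0 < m j" "\<And>j. m j \<le> K j" "\<And>j. m j *\<^sub>R mat 1 \<preceq> A j" "\<And>j. A j \<preceq> K j *\<^sub>R mat 1"
    by metis
  define m0 K0 where "m0 = Min (range m)" and "K0 = Max (range K)"
  have le: "m0 \<le> m j" "K j \<le> K0" for j by (auto simp: m0_def K0_def intro: Min_le Max_ge)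
  have "m0 \<in> range m" unfolding m0_def by (rule Min_in) auto
  then have "0 < m0" using mK(1) by auto
  moreover have "m0 \<le> K0" using le mK(2) order_trans by metis
  moreover have "m0 *\<^sub>R mat 1 \<preceq> A j" "A j \<preceq> K0 *\<^sub>R mat 1" for j
    using op_le_trans[OF scaleR_le_scaleR[OF PP_mat_1 le(1)] mK(3)]
      op_le_trans[OF mK(4) scaleR_le_scaleR[OF PP_mat_1 le(2)]] by blast+
  ultimately show thesis by (rule that)
qed

lemma tendsto_entry_sum:
  fixes T :: "'a \<Rightarrow> 'd::finite oper"
  assumes "(T \<longlongrightarrow> A) F"
  shows "((\<lambda>k. \<Sum>i\<in>UNIV. \<Sum>j\<in>UNIV. norm ((T k - A) $ i $ j)) \<longlongrightarrow> 0) F"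
proof -
  have "((\<lambda>k. \<Sum>i\<in>UNIV. \<Sum>j\<in>UNIV. norm ((T k - A) $ i $ j)) \<longlongrightarrow>
      (\<Sum>i\<in>(UNIV :: 'd set). \<Sum>j\<in>(UNIV :: 'd set). norm ((A - A) $ i $ j))) F"
    by (intro tendsto_intros assms)
  then show ?thesis by simp
qed

text \<open>An additive error of size \<open>e * m\<close> is absorbed into
  \<open>e *\<^sub>R A\<close>, since \<open>m\<close> bounds \<open>A\<close> from below. Monotone
  homogeneous maps respect the resulting multiplicative bounds.\<close>

lemma eventually_order_close:
  assumes A: "A \<in> PP" and T: "\<And>k. T k \<in> PP" "T \<longlonglongrightarrow> A" and e: "0 < e"
  shows "eventually (\<lambda>k. (1 - e) *\<^sub>R A \<preceq> T k \<and> T k \<preceq> (1 + e) *\<^sub>R A) sequentially"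
proof -
  obtain m where m: "0 < m" "m *\<^sub>R mat 1 \<preceq> A"
    using PP_bounds[OF A] by blast
  have "eventually (\<lambda>k. (\<Sum>i\<in>UNIV. \<Sum>j\<in>UNIV. norm ((T k - A) $ i $ j)) < e * m) sequentially"
    using order_tendstoD(2)[OF tendsto_entry_sum[OF T(2)], of "e * m"] e m(1) by simp
  then show ?thesis
  proof eventually_elim
    case (elim k)
    have "\<bar>x \<bullet> ((T k - A) *v x)\<bar> \<le> e * (x \<bullet> (A *v x))" for x
    proof -
      have "\<bar>x \<bullet> ((T k - A) *v x)\<bar> \<le> (e * m) * (norm x)\<^sup>2"
        using inner_matrix_vector_le[of x "T k - A"] mult_right_mono[OF less_imp_le[OF elim] zero_le_power2[of "norm x"]]
        by linarith
      also have "\<dots> \<le> e * (x \<bullet> (A *v x))"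
        using op_le_inner[OF m(2), of x] e by (simp add: inner_scaled_identity)
      finally show ?thesis .
    qed
    then have "(1 - e) * (x \<bullet> (A *v x)) \<le> x \<bullet> (T k *v x) \<and> x \<bullet> (T k *v x) \<le> (1 + e) * (x \<bullet> (A *v x))" for x
      by (simp add: matrix_vector_mult_diff_rdistrib inner_diff_right abs_le_iff algebra_simps)
    then show ?case
      using PP_selfadjoint[OF A] PP_selfadjoint[OF T(1)[of k]]
      by (simp add: op_le_iff scaleR_mat_vec selfadjoint_op_def cadjoint_diff cadjoint_scaleR)
  qed
qed

lemma tendsto_order_close:
  fixes B :: "'d::finite oper"
  assumes S: "\<And>e. 0 < e \<Longrightarrow> eventually (\<lambda>k. (1 - e) *\<^sub>R B \<preceq> S k \<and> S k \<preceq> (1 + e) *\<^sub>R B) sequentially"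
    and B: "selfadjoint_op B"
  shows "S \<longlonglongrightarrow> B"
proof (intro vec_tendstoI tendstoI)
  fix i j and \<epsilon> :: real assume \<epsilon>: "0 < \<epsilon>"
  define C where "C = (\<Sum>i\<in>UNIV. \<Sum>j\<in>UNIV. norm (B $ i $ j))"
  have C: "0 \<le> C" by (simp add: C_def sum_nonneg)
  \<comment> \<open>The entry bound gives an error of \<open>2 * (e * C)\<close>; the summand 1
    makes it strictly smaller than \<epsilon> and covers \<open>C = 0\<close>.\<close>
  define e where "e = \<epsilon> / (2 * C + 1)"
  have e: "0 < e" using \<epsilon> C by (simp add: e_def)
  have "2 * (e * C) < e * (2 * C + 1)" using e by (simp add: algebra_simps)
  also have "\<dots> = \<epsilon>" using C by (simp add: e_def)
  finally have small: "2 * (e * C) < \<epsilon>" .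
  show "eventually (\<lambda>k. dist (S k $ i $ j) (B $ i $ j) < \<epsilon>) sequentially"
    using S[OF e]
  proof eventually_elim
    case (elim k)
    have "norm ((S k - B) $ i $ j) \<le> 2 * (e * C)"
    proof (rule selfadjoint_entry_bound)
      have "selfadjoint_op ((1 - e) *\<^sub>R B)" using B by (simp add: selfadjoint_op_def cadjoint_scaleR)
      then have "selfadjoint_op (S k)" using elim selfadjoint_op_le by blast
      then show "selfadjoint_op (S k - B)" using B by (simp add: selfadjoint_op_def cadjoint_diff)
      fix x :: "complex ^ 'd"
      have "(1 - e) * (x \<bullet> (B *v x)) \<le> x \<bullet> (S k *v x)" "x \<bullet> (S k *v x) \<le> (1 + e) * (x \<bullet> (B *v x))"
        using elim op_le_inner[of _ _ x] by (metis inner_scaleR_right scaleR_mat_vec)+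
      then have "\<bar>x \<bullet> ((S k - B) *v x)\<bar> \<le> e * (x \<bullet> (B *v x))"
        by (simp add: matrix_vector_mult_diff_rdistrib inner_diff_right abs_le_iff algebra_simps)
      also have "\<dots> \<le> e * (C * (norm x)\<^sup>2)"
        using inner_matrix_vector_le[of x B] e unfolding C_def by (intro mult_left_mono) auto
      finally show "\<bar>x \<bullet> ((S k - B) *v x)\<bar> \<le> e * C * (norm x)\<^sup>2" by (simp add: mult.assoc)
    qed
    with small show ?case by (simp add: dist_norm)
  qed
qed

definition order_interval :: "real \<Rightarrow> real \<Rightarrow> 'd::finite oper set" where
  "order_interval m K = {X. m *\<^sub>R mat 1 \<preceq> X \<and> X \<preceq> K *\<^sub>R mat 1}"

lemma order_interval_PP: "0 < m \<Longrightarrow> order_interval m K \<subseteq> PP"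
  unfolding order_interval_def using PP_up[OF PP_scaleR[OF PP_mat_1]] by blast

lemma compact_order_interval:
  assumes "0 < m"
  shows "compact (order_interval m K :: 'd::finite oper set)"
  unfolding compact_eq_bounded_closed
proof
  show "bounded (order_interval m K :: 'd oper set)"
  proof (rule bounded_entries)
    fix X :: "'d oper" and i j assume X: "X \<in> order_interval m K"
    show "norm (X $ i $ j) \<le> 2 * K"
    proof (rule selfadjoint_entry_bound)
      show "selfadjoint_op X"
        using X order_interval_PP[OF assms] PP_selfadjoint by blast
      fix x :: "complex ^ 'd"
      have "m * (norm x)\<^sup>2 \<le> x \<bullet> (X *v x)" "x \<bullet> (X *v x) \<le> K * (norm x)\<^sup>2"
        using X op_le_inner[of _ _ x] by (auto simp: order_interval_def inner_scaled_identity[symmetric])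
      moreover have "0 \<le> m * (norm x)\<^sup>2" using assms by simp
      ultimately show "\<bar>x \<bullet> (X *v x)\<bar> \<le> K * (norm x)\<^sup>2" by linarith
    qed
  qed
  show "closed (order_interval m K :: 'd oper set)"
    unfolding closed_sequential_limits
  proof (intro allI impI, elim conjE)
    fix X :: "nat \<Rightarrow> 'd oper" and l assume X: "\<forall>n. X n \<in> order_interval m K" "X \<longlonglongrightarrow> l"
    then show "l \<in> order_interval m K"
      unfolding order_interval_def mem_Collect_eq
      by (intro conjI op_le_tendsto[OF tendsto_const X(2)] op_le_tendsto[OF X(2) tendsto_const]) auto
  qed
qed

lemma convex_order_interval: "convex (order_interval m K)"
proof (rule convexI)
  fix X Y :: "'a oper" and u v :: real
  assume *: "X \<in> order_interval m K" "Y \<in> order_interval m K" "0 \<le> u" "0 \<le> v" "u + v = 1"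
  have "c *\<^sub>R (mat 1 :: 'a oper) = u *\<^sub>R (c *\<^sub>R mat 1) + v *\<^sub>R (c *\<^sub>R mat 1)" for c
    using *(5) by (simp flip: scaleR_add_left distrib_right)
  then show "u *\<^sub>R X + v *\<^sub>R Y \<in> order_interval m K"
    using * unfolding order_interval_def mem_Collect_eq by (metis op_le_add op_le_scaleR)
qed

section \<open>Solutions for a fixed tuple \<open>A\<close>\<close>

locale mean_family =
  fixes M :: "('n::finite \<Rightarrow> 'd::finite oper) \<Rightarrow> 'd oper" and w :: "'n \<Rightarrow> real" and A :: "'n \<Rightarrow> 'd oper"
  assumes weights: "weight_vector w"
    and M_PP: "\<And>A. (\<forall>j. A j \<in> PP) \<Longrightarrow> M A \<in> PP"
    and M_mono: "joint_monotone M"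
    and M_hom: "pos_homogeneous M"
    and M_norm: "normalized M"
    and M_between: "between_HA w M"
    and A_PP: "\<And>j. A j \<in> PP"
begin

text \<open>Monotonicity and homogeneity carry multiplicative order bounds around \<open>B j\<close>
  over to \<open>M B\<close>, so \<open>M\<close> is continuous in norm along arbitrary convergent
  sequences in \<open>PP\<close>.\<close>

lemma M_tendsto:
  assumes T: "\<And>k j. T k j \<in> PP" and B: "\<And>j. B j \<in> PP" and lim: "\<And>j. (\<lambda>k. T k j) \<longlonglongrightarrow> B j"
  shows "(\<lambda>k. M (T k)) \<longlonglongrightarrow> M B"
proof (rule tendsto_order_close)
  show "selfadjoint_op (M B)" using M_PP B PP_selfadjoint by blast
  have *: "eventually (\<lambda>k. (1 - e) *\<^sub>R M B \<preceq> M (T k) \<and> M (T k) \<preceq> (1 + e) *\<^sub>R M B) sequentially"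
    if e: "0 < e" "e < 1" for e
  proof -
    have "eventually (\<lambda>k. \<forall>j\<in>UNIV. (1 - e) *\<^sub>R B j \<preceq> T k j \<and> T k j \<preceq> (1 + e) *\<^sub>R B j) sequentially"
      by (intro eventually_ball_finite ballI eventually_order_close B T lim e) simp
    then show ?thesis
    proof eventually_elim
      case (elim k)
      have PP: "(1 - e) *\<^sub>R B j \<in> PP" "(1 + e) *\<^sub>R B j \<in> PP" for j
        using e B by (auto intro!: PP_scaleR)
      have "M (\<lambda>j. (1 - e) *\<^sub>R B j) \<preceq> M (T k)" "M (T k) \<preceq> M (\<lambda>j. (1 + e) *\<^sub>R B j)"
        using M_mono elim PP T unfolding joint_monotone_def by auto
      then show ?case
        using M_hom e B by (simp add: pos_homogeneous_def)
    qed
  qed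
  show "eventually (\<lambda>k. (1 - e) *\<^sub>R M B \<preceq> M (T k) \<and> M (T k) \<preceq> (1 + e) *\<^sub>R M B) sequentially"
    if e: "0 < e" for e
  proof -
    have MB: "M B \<in> PP" using M_PP B by blast
    \<comment> \<open>Only for e < 1 does \<open>(1 - e) *\<^sub>R B j\<close> stay in
      \<open>PP\<close>, as homogeneity requires; larger e follow from smaller ones.\<close>
    define e' where "e' = min e (1/2)"
    have e': "0 < e'" "e' < 1" "e' \<le> e" using e by (auto simp: e'_def)
    from *[OF e'(1,2)] show ?thesis
    proof eventually_elim
      case (elim k)
      have "(1 - e) *\<^sub>R M B \<preceq> (1 - e') *\<^sub>R M B" "(1 + e') *\<^sub>R M B \<preceq> (1 + e) *\<^sub>R M B"
        using e' by (auto intro: scaleR_le_scaleR[OF MB])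
      then show ?case using elim op_le_trans by blast
    qed
  qed
qed

text \<open>For \<open>s = 0\<close> the power mean (\<open>r \<noteq> 0\<close>) and the Karcher mean (\<open>r = 0\<close>) solve one common equation.\<close>

definition solves :: "real \<times> real \<Rightarrow> 'd oper \<Rightarrow> bool" where
  "solves p X \<longleftrightarrow> (if fst p = 0 then arith_mean w (\<lambda>j. ka_mean (power_log (snd p)) X (A j)) = 0
     else X = M (\<lambda>j. ka_mean (power_fun (fst p) (snd p)) X (A j)))"

lemma solves_unique:
  assumes p: "p \<in> param_space" and X: "X \<in> PP" "solves p X" and Y: "Y \<in> PP" "solves p Y"
  shows "X = Y"
proof -
  have "X \<preceq> Y" if "X \<in> PP" "solves p X" "Y \<in> PP" "solves p Y" for X Y
  proof (cases "fst p = 0")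
    case True
    then show ?thesis
      using power_log_equation_le[OF weights A_PP, where r = "snd p" and X = X and Y = Y] p that by (auto simp: solves_def)
  next
    case False
    then have s: "0 < fst p" "fst p \<le> 1" and r: "-1 \<le> snd p" "snd p \<le> 1" using p by auto
    show ?thesis
      using that False s r
      by (intro fixed_point_le[OF M_mono M_hom power_fun_mean_monotone power_fun_pos power_fun_strict_mono A_PP])
        (auto simp: solves_def)
  qed
  then show ?thesis using X Y by (intro op_le_antisym) auto
qed

text \<open>The bounds \<open>H \<preceq> M \<preceq> A\<close> turn the fixed point equation for \<open>s > 0\<close> into two inequalities between
  difference quotients at \<open>s = 0\<close>, which survive the limit \<open>s \<rightarrow> 0\<close>.\<close>

lemma solves_slopes:
  assumes p: "p \<in> param_space" and X: "X \<in> PP" "solves p X"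
  shows "0 \<preceq> arith_mean w (\<lambda>j. ka_mean (upper_slope (fst p) (snd p)) X (A j))"
    and "arith_mean w (\<lambda>j. ka_mean (lower_slope (fst p) (snd p)) X (A j)) \<preceq> 0"
proof -
  obtain s r where sr: "p = (s, r)" by (cases p)
  have s: "0 \<le> s" "s \<le> 1" using p sr by auto
  show "0 \<preceq> arith_mean w (\<lambda>j. ka_mean (upper_slope (fst p) (snd p)) X (A j))"
    and "arith_mean w (\<lambda>j. ka_mean (lower_slope (fst p) (snd p)) X (A j)) \<preceq> 0"
  proof (atomize (full), cases "s = 0")
    case True
    have "upper_slope 0 r = power_log r" "lower_slope 0 r = power_log r"
      by (simp_all add: fun_eq_iff upper_slope_zero lower_slope_zero)
    then show "0 \<preceq> arith_mean w (\<lambda>j. ka_mean (upper_slope (fst p) (snd p)) X (A j)) \<and>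
        arith_mean w (\<lambda>j. ka_mean (lower_slope (fst p) (snd p)) X (A j)) \<preceq> 0"
      using X(2) by (simp add: sr True solves_def)
  next
    case False
    with s have s0: "0 < s" by simp
    let ?f = "power_fun s r"
    have fixed: "X = M (\<lambda>j. ka_mean ?f X (A j))"
      using X(2) False by (simp add: solves_def sr)
    have kPP: "ka_mean ?f X (A j) \<in> PP" for j
      by (intro ka_mean_PP X A_PP power_fun_pos s)
    have between: "harm_mean w (\<lambda>j. ka_mean ?f X (A j)) \<preceq> X" "X \<preceq> arith_mean w (\<lambda>j. ka_mean ?f X (A j))"
      using M_between kPP unfolding between_HA_def by (metis fixed)+
    have cancel: "0 \<preceq> B" if "0 \<preceq> s *\<^sub>R B" for B :: "'d oper"
      using op_le_scaleR[OF that, of "1 / s"] s0 by simp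
    \<comment> \<open>As f = 1 + s * upper slope and the constant 1 reproduces \<open>X\<close>, the
      term \<open>X\<close> cancels from the arithmetic bound.\<close>
    have "ka_mean ?f X (A j) = s *\<^sub>R ka_mean (upper_slope s r) X (A j) + 1 *\<^sub>R X" for j
      unfolding ka_mean_affine[OF X(1) A_PP, symmetric]
      by (rule ka_mean_cong[OF X(1) A_PP]) (simp add: mult_upper_slope s)
    then have "arith_mean w (\<lambda>j. ka_mean ?f X (A j)) = s *\<^sub>R arith_mean w (\<lambda>j. ka_mean (upper_slope s r) X (A j)) + 1 *\<^sub>R X"
      by (simp only: arith_mean_affine[OF weights])
    with between(2) have upper: "0 \<preceq> s *\<^sub>R arith_mean w (\<lambda>j. ka_mean (upper_slope s r) X (A j))"
      by (simp add: op_le_diff_iff[of X])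
    have "ka_mean (\<lambda>t. 1 / ?f t) X (A j) = (- s) *\<^sub>R ka_mean (lower_slope s r) X (A j) + 1 *\<^sub>R X" for j
      unfolding ka_mean_affine[OF X(1) A_PP, symmetric]
      by (rule ka_mean_cong[OF X(1) A_PP]) (simp add: mult_lower_slope s)
    then have lower_eq: "arith_mean w (\<lambda>j. ka_mean (\<lambda>t. 1 / ?f t) X (A j)) =
        (- s) *\<^sub>R arith_mean w (\<lambda>j. ka_mean (lower_slope s r) X (A j)) + 1 *\<^sub>R X"
      by (simp only: arith_mean_affine[OF weights])
    define H where "H = arith_mean w (\<lambda>j. matrix_inv (ka_mean ?f X (A j)))"
    have H: "H \<in> PP" unfolding H_def by (intro arith_mean_PP weights matrix_inv_PP kPP)
    \<comment> \<open>Inverting the harmonic bound and applying the congruence by \<open>X\<close>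
      yields X \<preceq> X H X, the arithmetic mean belonging to 1 / f = 1 - s * lower
      slope.\<close>
    have "matrix_inv X \<preceq> matrix_inv (matrix_inv H)"
      using between(1) by (intro matrix_inv_antimono matrix_inv_PP H) (simp add: harm_mean_eq H_def)
    then have "X ** matrix_inv X ** cadjoint X \<preceq> X ** H ** cadjoint X"
      by (intro op_le_congruence) (simp add: matrix_inv_PP(2)[OF H])
    moreover have "cadjoint X = X" using PP_selfadjoint[OF X(1)] by (simp add: selfadjoint_op_def)
    moreover have XX: "X ** matrix_inv X = mat 1" "matrix_inv X ** X = mat 1"
      using X(1) by (simp_all add: PP_def matrix_inv_mult)
    moreover have "X ** H ** X = arith_mean w (\<lambda>j. ka_mean (\<lambda>t. 1 / ?f t) X (A j))"
    proof -
      have "X ** matrix_inv (ka_mean ?f X (A j)) ** X = ka_mean (\<lambda>t. 1 / ?f t) X (A j)" for j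
        by (simp add: matrix_inv_ka_mean_congruence[OF X(1) A_PP power_fun_pos] s
            matrix_mul_assoc[symmetric] XX mult_cancel_left)
      then show ?thesis by (simp add: H_def congruence_arith_mean)
    qed
    ultimately have "X \<preceq> (- s) *\<^sub>R arith_mean w (\<lambda>j. ka_mean (lower_slope s r) X (A j)) + 1 *\<^sub>R X"
      by (simp add: lower_eq)
    then have "0 \<preceq> s *\<^sub>R (- arith_mean w (\<lambda>j. ka_mean (lower_slope s r) X (A j)))"
      by (simp add: op_le_diff_iff[of X])
    from cancel[OF this] have "arith_mean w (\<lambda>j. ka_mean (lower_slope s r) X (A j)) \<preceq> 0"
      by (simp add: op_le_def)
    with cancel[OF upper] show "0 \<preceq> arith_mean w (\<lambda>j. ka_mean (upper_slope (fst p) (snd p)) X (A j)) \<and>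
        arith_mean w (\<lambda>j. ka_mean (lower_slope (fst p) (snd p)) X (A j)) \<preceq> 0"
      by (simp add: sr)
  qed
qed

text \<open>If the limit has s = 0, the approximating parameters may or may not have s = 0. The
  slope inequalities hold in both cases, and in the limit they close up to one equation because the
  slopes agree at s = 0. Otherwise the fixed point equation itself passes to the limit.\<close>

lemma solves_limit:
  assumes p: "\<And>k. p k \<in> param_space" "q \<in> param_space" "p \<longlonglongrightarrow> q"
    and X: "\<And>k. X k \<in> PP" "Y \<in> PP" "X \<longlonglongrightarrow> Y" and sol: "\<And>k. solves (p k) (X k)"
  shows "solves q Y"
proof (cases "fst q = 0")
  case True
  have lim: "(\<lambda>k. arith_mean w (\<lambda>j. ka_mean (\<phi> (p k)) (X k) (A j))) \<longlonglongrightarrow> arith_mean w (\<lambda>j. ka_mean (\<phi> q) Y (A j))"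
    if "continuous_on (param_space \<times> {0<..}) (\<lambda>(p, t). \<phi> p t)" for \<phi>
    unfolding arith_mean_def by (intro tendsto_intros ka_mean_tendsto[OF that p X A_PP])
  have zero: "upper_slope (fst q) (snd q) = power_log (snd q)" "lower_slope (fst q) (snd q) = power_log (snd q)"
    by (simp_all add: fun_eq_iff True upper_slope_zero lower_slope_zero)
  let ?S = "arith_mean w (\<lambda>j. ka_mean (power_log (snd q)) Y (A j))"
  have "0 \<preceq> ?S"
    using op_le_tendsto[OF tendsto_const lim[OF continuous_on_upper_slope]] solves_slopes(1)[OF p(1) X(1) sol]
    by (simp add: zero)
  moreover have "?S \<preceq> 0"
    using op_le_tendsto[OF lim[OF continuous_on_lower_slope] tendsto_const] solves_slopes(2)[OF p(1) X(1) sol]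
    by (simp add: zero)
  ultimately have "?S = 0" by (intro op_le_antisym)
  then show ?thesis by (simp add: solves_def True)
next
  case False
  have PP: "ka_mean (power_fun (fst r) (snd r)) Z (A j) \<in> PP" if "r \<in> param_space" "Z \<in> PP" for r Z j
    using that by (intro ka_mean_PP A_PP power_fun_pos) auto
  have lim: "(\<lambda>k. M (\<lambda>j. ka_mean (power_fun (fst (p k)) (snd (p k))) (X k) (A j)))
      \<longlonglongrightarrow> M (\<lambda>j. ka_mean (power_fun (fst q) (snd q)) Y (A j))"
    by (intro M_tendsto PP p X) (intro ka_mean_tendsto[OF continuous_on_power_fun p X A_PP])
  have "eventually (\<lambda>k. fst (p k) \<noteq> 0) sequentially"
    using tendsto_imp_eventually_ne[OF tendsto_fst[OF p(3)] False] .
  then have "eventually (\<lambda>k. M (\<lambda>j. ka_mean (power_fun (fst (p k)) (snd (p k))) (X k) (A j)) = X k) sequentially"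
    by eventually_elim (use sol in \<open>simp add: solves_def\<close>)
  then have "X \<longlonglongrightarrow> M (\<lambda>j. ka_mean (power_fun (fst q) (snd q)) Y (A j))"
    using lim Lim_transform_eventually by blast
  from LIMSEQ_unique[OF X(3) this] show ?thesis
    using False by (simp add: solves_def)
qed

text \<open>The interval does not depend on \<open>p\<close>: solutions for varying parameters stay
  in one compact subset of \<open>PP\<close>.\<close>

lemma solution_in_order_interval:
  obtains m K where "0 < m" "\<And>p. p \<in> param_space \<Longrightarrow> \<exists>X\<in>order_interval m K. solves p X"
proof -
  obtain m K where m: "0 < m" "m \<le> K" and A: "\<And>j. m *\<^sub>R mat 1 \<preceq> A j" "\<And>j. A j \<preceq> K *\<^sub>R mat 1"
    using PP_family_bounds[of A] A_PP by blast
  define S where "S = (order_interval m K :: 'd oper set)"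
  have SPP: "S \<subseteq> PP" unfolding S_def by (rule order_interval_PP[OF m(1)])
  have compact: "compact S" unfolding S_def by (rule compact_order_interval[OF m(1)])
  have pos: "\<exists>X\<in>S. solves (s, r) X" if s: "0 < s" "s \<le> 1" and r: "-1 \<le> r" "r \<le> 1" for s r
  proof -
    define \<Phi> where "\<Phi> X = M (\<lambda>j. ka_mean (power_fun s r) X (A j))" for X
    have sr: "(s, r) \<in> param_space" using s r by simp
    have kPP: "ka_mean (power_fun s r) X B \<in> PP" if "X \<in> PP" "B \<in> PP" for X B :: "'d oper"
      using that s by (intro ka_mean_PP power_fun_pos) auto
    \<comment> \<open>By homogeneity and normalization the endpoints of the interval are reproduced,
      so monotonicity maps the interval into itself.\<close>
    have const: "M (\<lambda>j. ka_mean (power_fun s r) (c *\<^sub>R mat 1) (c *\<^sub>R mat 1)) = c *\<^sub>R mat 1" if "0 < c" for c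
    proof -
      have "power_fun s r 1 = 1" by (simp add: power_fun_def)
      then have "ka_mean (power_fun s r) (c *\<^sub>R mat 1) (c *\<^sub>R mat 1) = c *\<^sub>R (mat 1 :: 'd oper)"
        using that by (simp add: scaled_identity_congd ka_mean_congd[OF invertible_mat_one])
      then show ?thesis
        using M_hom[unfolded pos_homogeneous_def, rule_format, of c "\<lambda>j. mat 1"] M_norm that PP_mat_1
        by (simp add: normalized_def)
    qed
    have mono: "M (\<lambda>j. ka_mean (power_fun s r) X (B j)) \<preceq> M (\<lambda>j. ka_mean (power_fun s r) Y (C j))"
      if "X \<in> PP" "Y \<in> PP" "\<And>j. B j \<in> PP" "\<And>j. C j \<in> PP" "X \<preceq> Y" "\<And>j. B j \<preceq> C j" for X Y B C
      using M_mono kPP that mean_monotoneD[OF power_fun_mean_monotone[of s r, where 'd = 'd]] s r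
      unfolding joint_monotone_def by auto
    have IPP: "c *\<^sub>R mat 1 \<in> PP" if "0 < c" for c by (rule PP_scaleR[OF PP_mat_1 that])
    have "\<Phi> X \<in> S" if "X \<in> S" for X
    proof -
      have X: "X \<in> PP" "m *\<^sub>R mat 1 \<preceq> X" "X \<preceq> K *\<^sub>R mat 1"
        using that SPP by (auto simp: S_def order_interval_def)
      have K: "0 < K" using m by simp
      have "M (\<lambda>j. ka_mean (power_fun s r) (m *\<^sub>R mat 1) (m *\<^sub>R mat 1)) \<preceq> \<Phi> X"
        unfolding \<Phi>_def by (intro mono IPP m X A A_PP)
      moreover have "\<Phi> X \<preceq> M (\<lambda>j. ka_mean (power_fun s r) (K *\<^sub>R mat 1) (K *\<^sub>R mat 1))"
        unfolding \<Phi>_def by (intro mono IPP K X A A_PP)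
      ultimately show ?thesis
        unfolding const[OF m(1)] const[OF K] by (simp add: S_def order_interval_def)
    qed
    moreover have "continuous_on S \<Phi>"
      unfolding continuous_on_sequentially
    proof (intro allI ballI impI, elim conjE)
      fix X Y assume *: "Y \<in> S" "\<forall>n. X n \<in> S" "X \<longlonglongrightarrow> Y"
      then have PP: "\<And>n. X n \<in> PP" "Y \<in> PP" using SPP by auto
      have "(\<lambda>k. ka_mean (power_fun s r) (X k) (A j)) \<longlonglongrightarrow> ka_mean (power_fun s r) Y (A j)" for j
        using ka_mean_tendsto[OF continuous_on_power_fun, of "\<lambda>_. (s, r)" "(s, r)" X Y "A j"] sr PP *(3) A_PP by simp
      then show "(\<Phi> \<circ> X) \<longlonglongrightarrow> \<Phi> Y"
        unfolding o_def \<Phi>_def by (intro M_tendsto kPP PP A_PP)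
    qed
    moreover have "convex S" unfolding S_def by (rule convex_order_interval)
    moreover have "m *\<^sub>R mat 1 \<in> S"
      using m scaleR_le_scaleR[OF PP_mat_1] by (simp add: S_def order_interval_def)
    ultimately obtain X where "X \<in> S" "\<Phi> X = X"
      using brouwer[of S \<Phi>] compact by blast
    then show ?thesis
      using s by (intro bexI[of _ X]) (auto simp: solves_def \<Phi>_def)
  qed
  have zero: "\<exists>X\<in>S. solves (0, r) X" if r: "-1 \<le> r" "r \<le> 1" for r
  proof -
    \<comment> \<open>s = 1 / (k + 1) tends to 0 with \<open>r\<close> fixed; a cluster point of the
      solutions solves the equation at s = 0.\<close>
    define p :: "nat \<Rightarrow> real \<times> real" where "p k = (inverse (real (Suc k)), r)" for k
    have "\<exists>X\<in>S. solves (p k) X" for k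
      unfolding p_def using r by (intro pos) (simp_all add: inverse_le_1_iff)
    then obtain X where X: "\<And>k. X k \<in> S" "\<And>k. solves (p k) (X k)" by metis
    obtain Y \<sigma> where Y: "Y \<in> S" "strict_mono \<sigma>" "(X \<circ> \<sigma>) \<longlonglongrightarrow> Y"
      using compact X(1) unfolding compact_def by metis
    have "p \<longlonglongrightarrow> (0, r)"
      unfolding p_def by (intro tendsto_intros LIMSEQ_inverse_real_of_nat)
    from LIMSEQ_subseq_LIMSEQ[OF this Y(2)] have "(p \<circ> \<sigma>) \<longlonglongrightarrow> (0, r)" .
    moreover have "(p \<circ> \<sigma>) k \<in> param_space" for k
      using r by (simp add: p_def inverse_le_1_iff)
    ultimately have "solves (0, r) Y"
      using r X Y SPP by (intro solves_limit[of "p \<circ> \<sigma>" "(0, r)" "X \<circ> \<sigma>"]) auto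
    with Y(1) show ?thesis by blast
  qed
  have "\<exists>X\<in>order_interval m K. solves p X" if "p \<in> param_space" for p
    using that pos[of "fst p" "snd p"] zero[of "snd p"] unfolding S_def[symmetric]
    by (cases "fst p = 0") (auto simp: mem_Times_iff, metis prod.collapse)
  with m(1) show thesis by (rule that)
qed

text \<open>In each branch \<open>X\<close> witnesses existence and \<open>solves_unique\<close>
  gives uniqueness for the definite description, once the defining equation is translated into
  \<open>solves\<close>.\<close>

lemma deformed_family_eqI:
  assumes p: "(s, r) \<in> param_space" and X: "X \<in> PP" "solves (s, r) X"
  shows "deformed_family M w s r A = X"
proof -
  have uniq: "Y = X" if "Y \<in> PP" "solves (s, r) Y" for Y
    using solves_unique[OF p that X] .
  consider "s \<noteq> 0" | "s = 0" "0 < r" | "s = 0" "r = 0" | "s = 0" "r < 0" by linarith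
  then show ?thesis
  proof cases
    case 1
    have "(Y = M (\<lambda>j. bin_power_mean s r Y (A j))) \<longleftrightarrow> solves (s, r) Y" for Y
      using 1 by (simp add: bin_power_mean_eq solves_def)
    then have "(Y \<in> PP \<and> Y = M (\<lambda>j. bin_power_mean s r Y (A j))) \<longleftrightarrow> Y = X" for Y
      using X uniq by blast
    then show ?thesis
      using 1 by (simp add: deformed_family_def deformed_mean_def)
  next
    case 2
    have "(Y = arith_mean w (\<lambda>j. geo_mean r Y (A j))) \<longleftrightarrow> solves (s, r) Y" if "Y \<in> PP" for Y
      using power_mean_equation_pos[OF weights that A_PP] 2 by (simp add: solves_def)
    then have "(Y \<in> PP \<and> Y = arith_mean w (\<lambda>j. geo_mean r Y (A j))) \<longleftrightarrow> Y = X" for Y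
      using X uniq by blast
    then show ?thesis
      using 2 by (simp add: deformed_family_def power_mean_def)
  next
    case 3
    have "((\<Sum>j\<in>UNIV. w j *\<^sub>R op_log (op_powr Y (-1/2) ** A j ** op_powr Y (-1/2))) = 0) \<longleftrightarrow> solves (s, r) Y"
      if "Y \<in> PP" for Y
      using karcher_equation[OF that, of w A] 3 by (simp add: solves_def)
    then have "(Y \<in> PP \<and> (\<Sum>j\<in>UNIV. w j *\<^sub>R op_log (op_powr Y (-1/2) ** A j ** op_powr Y (-1/2))) = 0) \<longleftrightarrow> Y = X" for Y
      using X uniq by blast
    then show ?thesis
      using 3 by (simp add: deformed_family_def karcher_mean_def)
  next
    case 4
    have "(Y = harm_mean w (\<lambda>j. geo_mean (- r) Y (A j))) \<longleftrightarrow> solves (s, r) Y" if "Y \<in> PP" for Y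
      using power_mean_equation_neg[OF weights that A_PP] 4 by (simp add: solves_def)
    then have "(Y \<in> PP \<and> Y = harm_mean w (\<lambda>j. geo_mean (- r) Y (A j))) \<longleftrightarrow> Y = X" for Y
      using X uniq by blast
    then show ?thesis
      using 4 by (simp add: deformed_family_def power_mean_def)
  qed
qed

theorem deformed_family_continuous:
  shows "\<And>s r. s \<in> {0..1} \<Longrightarrow> r \<in> {-1..1} \<Longrightarrow> deformed_family M w s r A \<in> PP"
    and "continuous_on param_space (\<lambda>(s, r). deformed_family M w s r A)"
proof -
  obtain m K where m: "0 < m" and ex: "\<And>p. p \<in> param_space \<Longrightarrow> \<exists>X\<in>order_interval m K. solves p X"
    by (rule solution_in_order_interval) blast
  let ?S = "order_interval m K :: 'd oper set"
  have SPP: "?S \<subseteq> PP" by (rule order_interval_PP[OF m])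
  define F where "F = (\<lambda>(s, r). deformed_family M w s r A)"
  have F: "F p \<in> ?S" "solves p (F p)" if p: "p \<in> param_space" for p
  proof -
    obtain X where X: "X \<in> ?S" "solves p X" using ex[OF p] by blast
    then have "F p = X"
      using deformed_family_eqI[of "fst p" "snd p" X] p SPP by (auto simp: F_def case_prod_unfold)
    with X show "F p \<in> ?S" "solves p (F p)" by simp_all
  qed
  show "deformed_family M w s r A \<in> PP" if "s \<in> {0..1}" "r \<in> {-1..1}" for s r
    using F(1)[of "(s, r)"] that SPP by (auto simp: F_def)
  have "continuous_on param_space F"
  proof (rule continuous_from_closed_graph)
    show "compact ?S" by (rule compact_order_interval[OF m])
    show "F \<in> param_space \<rightarrow> ?S" using F by blast
    show "closed ((\<lambda>p. (p, F p)) ` param_space)"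
      unfolding closed_sequential_limits
    proof (intro allI impI, elim conjE)
      fix x :: "nat \<Rightarrow> (real \<times> real) \<times> 'd oper" and l
      assume x: "\<forall>n. x n \<in> (\<lambda>p. (p, F p)) ` param_space" "x \<longlonglongrightarrow> l"
      obtain q Y where l: "l = (q, Y)" by (cases l)
      define p where "p k = fst (x k)" for k
      have p: "p k \<in> param_space" "x k = (p k, F (p k))" for k
      proof -
        have "x k \<in> (\<lambda>p. (p, F p)) ` param_space" using x(1) by blast
        then obtain p' where "p' \<in> param_space" "x k = (p', F p')" by (rule imageE)
        then show "p k \<in> param_space" "x k = (p k, F (p k))" by (simp_all add: p_def)
      qed
      have lim: "p \<longlonglongrightarrow> q" "(\<lambda>k. F (p k)) \<longlonglongrightarrow> Y"
        using tendsto_fst[OF x(2)] tendsto_snd[OF x(2)] by (simp_all add: p(2) l)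
      have "closed param_space" by (intro closed_Times) auto
      then have q: "q \<in> param_space"
        using closed_sequentially[OF _ _ lim(1)] p(1) by blast
      have "Y \<in> ?S"
        using closed_sequentially[OF compact_imp_closed[OF compact_order_interval[OF m]] _ lim(2)] F(1)[OF p(1)] by blast
      then have Y: "Y \<in> PP" using SPP by blast
      have "solves q Y"
        using F(1)[OF p(1)] F(2)[OF p(1)] SPP by (intro solves_limit[OF p(1) q lim(1) _ Y lim(2)]) blast+
      then have "F q = Y"
        using deformed_family_eqI[of "fst q" "snd q" Y] q Y by (simp add: F_def case_prod_unfold)
      then show "l \<in> (\<lambda>p. (p, F p)) ` param_space" using q l by auto
    qed
  qed
  then show "continuous_on param_space (\<lambda>(s, r). deformed_family M w s r A)" by (simp add: F_def)
qed

end

text \<open>The sum of the moduli of the entries dominates the operator norm and tends to 0 under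
  convergence of matrices.\<close>

lemma opnorm_continuous_on_if_continuous_on:
  assumes "continuous_on S F"
  shows "opnorm_continuous_on S F"
  unfolding opnorm_continuous_on_def
proof
  fix p assume "p \<in> S"
  then have "(F \<longlongrightarrow> F p) (at p within S)"
    using assms by (simp add: continuous_on_def)
  note lim = tendsto_entry_sum[OF this]
  show "((\<lambda>q. opnorm (F q - F p)) \<longlongrightarrow> 0) (at p within S)"
  proof (rule tendsto_sandwich[OF _ _ tendsto_const lim])
    show "eventually (\<lambda>q. 0 \<le> opnorm (F q - F p)) (at p within S)"
      by (intro always_eventually allI) (simp add: opnorm_def onorm_pos_le)
    show "eventually (\<lambda>q. opnorm (F q - F p) \<le> (\<Sum>i\<in>UNIV. \<Sum>j\<in>UNIV. norm ((F q - F p) $ i $ j))) (at p within S)"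
      by (intro always_eventually allI opnorm_le)
  qed
qed

theorem theorem4p11:
  fixes M :: "('n::finite \<Rightarrow> complex ^ 'd ^ 'd) \<Rightarrow> complex ^ 'd ^ 'd"
    and w :: "'n \<Rightarrow> real"
  assumes "CARD('n) \<ge> 2"
    and "weight_vector w"
    and "\<And>A. (\<forall>j. A j \<in> PP) \<Longrightarrow> M A \<in> PP"
    and "joint_monotone M"
    and "pos_homogeneous M"
    and "monotone_continuous M"
    and "normalized M"
    and "between_HA w M"
  shows "\<forall>A. (\<forall>j. A j \<in> PP) \<longrightarrow>
           (\<forall>s\<in>{0..1}. \<forall>r\<in>{-1..1}. deformed_family M w s r A \<in> PP) \<and>
           opnorm_continuous_on ({0..1} \<times> {-1..1}) (\<lambda>(s, r). deformed_family M w s r A)"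
proof (intro allI impI)
  fix A :: "'n \<Rightarrow> complex ^ 'd ^ 'd"
  assume "\<forall>j. A j \<in> PP"
  then interpret mean_family M w A
    using assms by unfold_locales auto
  show "(\<forall>s\<in>{0..1}. \<forall>r\<in>{-1..1}. deformed_family M w s r A \<in> PP) \<and>
      opnorm_continuous_on ({0..1} \<times> {-1..1}) (\<lambda>(s, r). deformed_family M w s r A)"
    using deformed_family_continuous opnorm_continuous_on_if_continuous_on by blast
qed

end
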